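(* Let $G$ be a finite group, $\omega\colon G^3\to\mathbb C^\times$ a normalized 3-cocycle, and let $U,V,W$ be simple objects of $\mathcal Z(\mathrm{Vec}_G^\omega)$ corresponding to pairs $(g,\chi_1)$, $(h,\chi_2)$, $(k,\chi_3)$. For $x,x',y,z\in G$ with $x'=z^{-1}\triangleright x$ put $$\psi(x,x',y,z)=\omega^{-1}(y,z,x')\,\omega(y,x,z)\,\alpha_x^{-1}(z,z^{-1})=\omega^{-1}(y,z,x')\,\omega(y,x,z)\,\alpha_{x'}^{-1}(z^{-1},z),$$ and consider the conditions $$(\ast)\qquad [[y^{-1},x],z]=1,\quad [[z,y],x]=1,\quad [[z^{-1},x^{-1}],y]=1.$$ Put $$\begin{aligned}\Omega(x,y,z)=\ &\psi(x,z^{-1}\triangleright x,x\triangleright y,z)\,\psi(x\triangleright y,y,y\triangleright z,z^{-1}\triangleright x)\,\psi(y\triangleright z,z,x,y)\\=\ &\omega(x\triangleright y,z,z^{-1}\triangleright x)\,\omega^{-1}(x\triangleright y,x,z)\,\alpha_x^{-1}(z,z^{-1})\\&\cdot\omega(y\triangleright z,z^{-1}\triangleright x,y)\,\omega^{-1}(y\triangleright z,x\triangleright y,z^{-1}\triangleright x)\,\alpha_y^{-1}(z^{-1}\triangleright x^{-1},z^{-1}\triangleright x)\\&\cdot\omega(x,y,z)\,\omega^{-1}(x,y\triangleright z,y)\,\alpha_z(y^{-1},y).\end{aligned}$$ Then the Borromean tensor of $\mathcal Z(\mathrm{Vec}_G^\omega)$ is given by $$B_{(g,\chi_1),(h,\chi_2),(k,\chi_3)}=\sum_{\substack{x\in\overline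 g,\ y\in\overline h,\ z\in\overline k\\ (\ast)}}\Omega(x,y,z)\,\chi_1^x([y,z])\,\chi_2^y([z^{-1},x^{-1}])\,\chi_3^z([y,x]).$$ Moreover, the three summations can be reduced to two: $$B_{(g,\chi_1),(h,\chi_2),(k,\chi_3)}=|\overline k|\sum_{(x,y)}\Omega(x,y,k)\,\chi_1^x([y,k])\,\chi_2^y([k^{-1},x^{-1}])\,\chi_3([y,x]),$$ where the sum is over all $x\in\overline g$, $y\in\overline h$ with $[[k,y],x]=1$ and $[[y^{-1},x],k]=1$. Finally, $$\begin{aligned}B_{(g,\chi_1),(h,\chi_2),(k,\chi_3)}&=|\overline k|\sum_{\substack{p\in G/C_G(g)\\ q\in G/C_G(h)}}\Omega(p\triangleright g,q\triangleright h,k)\,(p\triangleright\chi_1)([q\triangleright h,k])\,(q\triangleright\chi_2)([k^{-1},p\triangleright g^{-1}])\,\chi_3([q\triangleright h,p\triangleright g])\\&=\frac{|\overline g||\overline h||\overline k|}{|G|^2}\sum_{p,q\in G}\Omega(p\triangleright g,q\triangleright h,k)\,(p\triangleright\chi_1)([q\triangleright h,k])\,(q\triangleright\chi_2)([k^{-1},p\triangleright g^{-1}])\,\chi_3([q\triangleright h,p\triangleright g]),\end{aligned}$$ where in both sums $p,q$ are subject to $[[k,q\triangleright h],p\triangleright g]=1$ and $[[(q\triangleright h)^{-1},p\triangleright g],k]=1$.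
   Context: **Notation.** $g\triangleright h=ghg^{-1}$, $[g,h]=ghg^{-1}h^{-1}$, $\overline g$ is the conjugacy class of $g$, $C_G(g)$ its centralizer; $\omega^{-1}$ and $\alpha^{-1}$ denote multiplicative inverses of values. **The category.** $\mathrm{Vec}_G^\omega$ is the category of finite-dimensional $G$-graded vector spaces with associativity isomorphism $\Phi\colon (U\otimes V)\otimes W\to U\otimes(V\otimes W)$, $(u\otimes v)\otimes w\mapsto\omega(|u|,|v|,|w|)\,u\otimes(v\otimes w)$ on homogeneous elements ($|u|$ is the degree of $u$). $\mathcal Z(\mathrm{Vec}_G^\omega)$ is the (right) Drinfeld center: objects are graded spaces $W$ with linear maps $g\triangleright\colon W\to W$ ($g\in G$) satisfying $|g\triangleright w|=g\triangleright|w|$, $e\triangleright w=w$, $g\triangleright(h\triangleright w)=\alpha_{|w|}(g,h)\,(gh)\triangleright w$, where $\alpha_g(x,y)=\omega(x,y,g)\,\omega^{-1}(x,y\triangleright g,y)\,\omega((xy)\triangleright g,x,y)$; the braiding is $\sigma_{V,W}(v\otimes w)=|v|\triangleright w\otimes v$. It is a modular category with the spherical structure for which pivotal traces are ordinary traces of linear maps. Simple objects are parametrized by pairs $(g,\chi)$, with $g$ running over representatives of conjugacy classes and $\chi$ an irreducible $\alpha_g$-projective character of $C_G(g)$: the simple $V$ has support $\overline g$, and $\chi$ is the character of $C_G(g)$ acting on the homogeneous component $V_g$. **Transported characters.** If $V$ corresponds to $(g,\chi)$ and $x=f\triangleright g$, then $\chi^x=f\triangleright\chi$ is the projective character of $C_G(x)$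 acting on $V_x$, given by $(f\triangleright\chi)(c)=\alpha_g(c,f)\,\alpha_g^{-1}(f,f^{-1}\triangleright c)\,\chi(f^{-1}\triangleright c)$; it is independent of the choice of $f$. **Borromean tensor.** For simple objects $U,V,W$, $B_{U,V,W}=\mathrm{ptr}\left(R((\sigma_2^{-1}\sigma_1)^3)\right)$, the pivotal trace of the automorphism of $(U\otimes V)\otimes W$ given by the pure braid $(\sigma_2^{-1}\sigma_1)^3\in\mathbb B_3$ (with $\sigma_1$ acting first), where $R$ sends $\sigma_1$ to the braiding of the first two tensor factors and $\sigma_2$ to the braiding of the last two (conjugated by associativity isomorphisms), and $R(\beta\beta')=R(\beta)R(\beta')$.
   Formalization: α_g is replaced by its inverse, as the hexagon requires; Ω's second form is corrected to match ψ; Ω gains the factor α_x(y▷z,z⁻¹)α_y(z⁻¹▷x⁻¹,x)α_z(y⁻¹,x▷y); χ₃ is evaluated at [y⁻¹,x], not [y,x]. As printed it fails for G=Z₂, ω(1,1,1)=−1. *)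

theory Defs
  imports "HOL-Analysis.Analysis" "HOL-Algebra.Left_Coset"
begin

definition conjugate :: "('a, 'b) monoid_scheme \<Rightarrow> 'a \<Rightarrow> 'a \<Rightarrow> 'a"
    (\<open>(_ \<triangleright>\<index> _)\<close> [76, 75] 75)
  where "g \<triangleright>\<^bsub>G\<^esub> h = g \<otimes>\<^bsub>G\<^esub> h \<otimes>\<^bsub>G\<^esub> inv\<^bsub>G\<^esub> g"

definition commutator :: "('a, 'b) monoid_scheme \<Rightarrow> 'a \<Rightarrow> 'a \<Rightarrow> 'a"
    (\<open>\<lbrakk>_,/ _\<rbrakk>\<index>\<close>)
  where "\<lbrakk>g, h\<rbrakk>\<^bsub>G\<^esub> = g \<otimes>\<^bsub>G\<^esub> h \<otimes>\<^bsub>G\<^esub> inv\<^bsub>G\<^esub> g \<otimes>\<^bsub>G\<^esub> inv\<^bsub>G\<^esub> h"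

definition conj_class :: "('a, 'b) monoid_scheme \<Rightarrow> 'a \<Rightarrow> 'a set"
  where "conj_class G g = (\<lambda>f. f \<triangleright>\<^bsub>G\<^esub> g) ` carrier G"

definition centralizer :: "('a, 'b) monoid_scheme \<Rightarrow> 'a \<Rightarrow> 'a set"
  where "centralizer G g = {c \<in> carrier G. c \<otimes>\<^bsub>G\<^esub> g = g \<otimes>\<^bsub>G\<^esub> c}"

definition left_transversal :: "('a, 'b) monoid_scheme \<Rightarrow> 'a set \<Rightarrow> 'a set \<Rightarrow> bool"
  where "left_transversal G H T \<longleftrightarrow>
    T \<subseteq> carrier G \<and> (\<forall>C \<in> lcosets\<^bsub>G\<^esub> H. \<exists>!p. p \<in> T \<and> p \<in> C)"

definition normalized_3cocycle ::
    "('a, 'b) monoid_scheme \<Rightarrow> ('a \<Rightarrow> 'a \<Rightarrow> 'a \<Rightarrow> complex) \<Rightarrow> bool"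
  where "normalized_3cocycle G \<omega> \<longleftrightarrow>
    (\<forall>a\<in>carrier G. \<forall>b\<in>carrier G. \<forall>c\<in>carrier G. \<omega> a b c \<noteq> 0) \<and>
    (\<forall>a\<in>carrier G. \<forall>b\<in>carrier G. \<forall>c\<in>carrier G. \<forall>d\<in>carrier G.
       \<omega> b c d * \<omega> a (b \<otimes>\<^bsub>G\<^esub> c) d * \<omega> a b c = \<omega> (a \<otimes>\<^bsub>G\<^esub> b) c d * \<omega> a b (c \<otimes>\<^bsub>G\<^esub> d)) \<and>
    (\<forall>a\<in>carrier G. \<forall>b\<in>carrier G.
       \<omega> \<one>\<^bsub>G\<^esub> a b = 1 \<and> \<omega> a \<one>\<^bsub>G\<^esub> b = 1 \<and> \<omega> a b \<one>\<^bsub>G\<^esub> = 1)"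

text \<open>
  The multiplier \<open>\<alpha>\<^sub>g(x, y)\<close> of \<open>x \<triangleright> (y \<triangleright> w) = \<alpha>\<^sub>g(x, y) (xy) \<triangleright> w\<close> for \<open>w\<close> of degree \<open>g\<close>.
  With \<open>\<Phi> ((u \<otimes> v) \<otimes> w) = \<omega>(|u|, |v|, |w|) u \<otimes> (v \<otimes> w)\<close> and
  \<open>\<sigma> (v \<otimes> w) = |v| \<triangleright> w \<otimes> v\<close>, the hexagon
  \<open>\<Phi>\<^sup>-\<^sup>1 \<circ> \<sigma>\<^bsub>U\<otimes>V,W\<^esub> = (\<sigma>\<^bsub>U,W\<^esub> \<otimes> id) \<circ> \<Phi>\<^sup>-\<^sup>1 \<circ> (id \<otimes> \<sigma>\<^bsub>V,W\<^esub>) \<circ> \<Phi>\<close>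
  evaluated at \<open>(u \<otimes> v) \<otimes> w\<close> with \<open>|u| = x\<close>, \<open>|v| = y\<close> forces the value below, which is the
  inverse of the expression \<open>\<omega>(x,y,g) \<omega>\<^sup>-\<^sup>1(x,y\<triangleright>g,y) \<omega>((xy)\<triangleright>g,x,y)\<close> that belongs to the
  opposite convention for \<open>\<Phi>\<close>.
\<close>
definition alpha ::
    "('a, 'b) monoid_scheme \<Rightarrow> ('a \<Rightarrow> 'a \<Rightarrow> 'a \<Rightarrow> complex) \<Rightarrow> 'a \<Rightarrow> 'a \<Rightarrow> 'a \<Rightarrow> complex"
  where "alpha G \<omega> g x y =
    inverse (\<omega> x y g) * \<omega> x (y \<triangleright>\<^bsub>G\<^esub> g) y * inverse (\<omega> ((x \<otimes>\<^bsub>G\<^esub> y) \<triangleright>\<^bsub>G\<^esub> g) x y)"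

text \<open>
  A finite-dimensional vector space is \<open>complex ^ 'n\<close>, with arbitrary (not necessarily
  coordinate) homogeneous components. As \<open>'n\<close> is nonempty, these spaces are nonzero.
\<close>
record ('a, 'n::finite) graded_rep =
  component :: "'a \<Rightarrow> (complex ^ 'n) set"
  action :: "'a \<Rightarrow> complex ^ 'n \<Rightarrow> complex ^ 'n"

abbreviation clinear :: "(complex ^ 'n::finite \<Rightarrow> complex ^ 'm::finite) \<Rightarrow> bool"
  where "clinear \<equiv> Vector_Spaces.linear (*s) (*s)"

definition decomposition ::
    "('a, 'b) monoid_scheme \<Rightarrow> ('a \<Rightarrow> (complex ^ 'n::finite) set) \<Rightarrow> complex ^ 'n
      \<Rightarrow> ('a \<Rightarrow> complex ^ 'n) \<Rightarrow> bool"
  where "decomposition G W v c \<longleftrightarrow>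
    c \<in> (\<Pi>\<^sub>E x\<in>carrier G. W x) \<and> v = (\<Sum>x\<in>carrier G. c x)"

definition grading :: "('a, 'b) monoid_scheme \<Rightarrow> ('a \<Rightarrow> (complex ^ 'n::finite) set) \<Rightarrow> bool"
  where "grading G W \<longleftrightarrow>
    (\<forall>x\<in>carrier G. vec.subspace (W x)) \<and> (\<forall>v. \<exists>!c. decomposition G W v c)"

definition proj ::
    "('a, 'b) monoid_scheme \<Rightarrow> ('a, 'n::finite) graded_rep \<Rightarrow> 'a \<Rightarrow> complex ^ 'n \<Rightarrow> complex ^ 'n"
  where "proj G V x v = (THE c. decomposition G (component V) v c) x"

definition center_object ::
    "('a, 'b) monoid_scheme \<Rightarrow> ('a \<Rightarrow> 'a \<Rightarrow> 'a \<Rightarrow> complex) \<Rightarrow> ('a, 'n::finite) graded_rep \<Rightarrow> bool"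
  where "center_object G \<omega> V \<longleftrightarrow>
    grading G (component V) \<and>
    (\<forall>g\<in>carrier G. clinear (action V g)) \<and>
    (\<forall>g\<in>carrier G. \<forall>x\<in>carrier G. \<forall>w\<in>component V x. action V g w \<in> component V (g \<triangleright>\<^bsub>G\<^esub> x)) \<and>
    (\<forall>w. action V \<one>\<^bsub>G\<^esub> w = w) \<and>
    (\<forall>g\<in>carrier G. \<forall>h\<in>carrier G. \<forall>x\<in>carrier G. \<forall>w\<in>component V x.
       action V g (action V h w) = alpha G \<omega> x g h *s action V (g \<otimes>\<^bsub>G\<^esub> h) w)"

definition subobject ::
    "('a, 'b) monoid_scheme \<Rightarrow> ('a, 'n::finite) graded_rep \<Rightarrow> (complex ^ 'n) set \<Rightarrow> bool"
  where "subobject G V S \<longleftrightarrow>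
    vec.subspace S \<and>
    (\<forall>x\<in>carrier G. \<forall>v\<in>S. proj G V x v \<in> S) \<and>
    (\<forall>g\<in>carrier G. \<forall>v\<in>S. action V g v \<in> S)"

definition simple_object ::
    "('a, 'b) monoid_scheme \<Rightarrow> ('a \<Rightarrow> 'a \<Rightarrow> 'a \<Rightarrow> complex) \<Rightarrow> ('a, 'n::finite) graded_rep \<Rightarrow> bool"
  where "simple_object G \<omega> V \<longleftrightarrow>
    center_object G \<omega> V \<and> (\<forall>S. subobject G V S \<longrightarrow> S = {0} \<or> S = UNIV)"

text \<open>
  The trace of \<open>c \<triangleright> _\<close> on the component of degree \<open>x\<close>, for \<open>c\<close> centralizing \<open>x\<close>: composing with
  the projection extends that endomorphism by zero to the other components.
\<close>
definition component_trace ::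
    "('a, 'b) monoid_scheme \<Rightarrow> ('a, 'n::finite) graded_rep \<Rightarrow> 'a \<Rightarrow> 'a \<Rightarrow> complex"
  where "component_trace G V x c = trace (matrix (\<lambda>w. action V c (proj G V x w)))"

definition corresponds ::
    "('a, 'b) monoid_scheme \<Rightarrow> ('a \<Rightarrow> 'a \<Rightarrow> 'a \<Rightarrow> complex) \<Rightarrow> ('a, 'n::finite) graded_rep
      \<Rightarrow> 'a \<Rightarrow> ('a \<Rightarrow> complex) \<Rightarrow> bool"
  where "corresponds G \<omega> V g \<xi> \<longleftrightarrow>
    simple_object G \<omega> V \<and> g \<in> carrier G \<and>
    {x \<in> carrier G. component V x \<noteq> {0}} = conj_class G g \<and>
    (\<forall>c\<in>centralizer G g. \<xi> c = component_trace G V g c)"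

definition transport_char ::
    "('a, 'b) monoid_scheme \<Rightarrow> ('a \<Rightarrow> 'a \<Rightarrow> 'a \<Rightarrow> complex) \<Rightarrow> 'a \<Rightarrow> ('a \<Rightarrow> complex)
      \<Rightarrow> 'a \<Rightarrow> 'a \<Rightarrow> complex"
  where "transport_char G \<omega> g \<xi> f c =
    alpha G \<omega> g c f * inverse (alpha G \<omega> g f (inv\<^bsub>G\<^esub> f \<triangleright>\<^bsub>G\<^esub> c)) * \<xi> (inv\<^bsub>G\<^esub> f \<triangleright>\<^bsub>G\<^esub> c)"

definition char_at ::
    "('a, 'b) monoid_scheme \<Rightarrow> ('a \<Rightarrow> 'a \<Rightarrow> 'a \<Rightarrow> complex) \<Rightarrow> 'a \<Rightarrow> ('a \<Rightarrow> complex)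
      \<Rightarrow> 'a \<Rightarrow> 'a \<Rightarrow> complex"
  where "char_at G \<omega> g \<xi> x =
    transport_char G \<omega> g \<xi> (SOME f. f \<in> carrier G \<and> f \<triangleright>\<^bsub>G\<^esub> g = x)"

definition tensor ::
    "complex ^ 'n::finite \<Rightarrow> complex ^ 'm::finite \<Rightarrow> complex ^ ('n \<times> 'm)"  (infixr \<open>\<otimes>\<^sub>v\<close> 72)
  where "v \<otimes>\<^sub>v w = (\<chi> p. v $ fst p * w $ snd p)"

definition tensor_map ::
    "(complex ^ 'n::finite \<Rightarrow> complex ^ 'p::finite) \<Rightarrow> (complex ^ 'm::finite \<Rightarrow> complex ^ 'q::finite)
      \<Rightarrow> complex ^ ('n \<times> 'm) \<Rightarrow> complex ^ ('p \<times> 'q)"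
  where "tensor_map f g =
    (THE F. clinear F \<and> (\<forall>v w. F (v \<otimes>\<^sub>v w) = f v \<otimes>\<^sub>v g w))"

definition associator ::
    "('a, 'b) monoid_scheme \<Rightarrow> ('a \<Rightarrow> 'a \<Rightarrow> 'a \<Rightarrow> complex)
      \<Rightarrow> ('a, 'i::finite) graded_rep \<Rightarrow> ('a, 'j::finite) graded_rep \<Rightarrow> ('a, 'l::finite) graded_rep
      \<Rightarrow> complex ^ (('i \<times> 'j) \<times> 'l) \<Rightarrow> complex ^ ('i \<times> ('j \<times> 'l))"
  where "associator G \<omega> U V W =
    (THE F. clinear F \<and>
      (\<forall>x\<in>carrier G. \<forall>y\<in>carrier G. \<forall>z\<in>carrier G.
       \<forall>u\<in>component U x. \<forall>v\<in>component V y. \<forall>w\<in>component W z.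
         F ((u \<otimes>\<^sub>v v) \<otimes>\<^sub>v w) = \<omega> x y z *s (u \<otimes>\<^sub>v (v \<otimes>\<^sub>v w))))"

definition braiding ::
    "('a, 'b) monoid_scheme \<Rightarrow> ('a, 'i::finite) graded_rep \<Rightarrow> ('a, 'j::finite) graded_rep
      \<Rightarrow> complex ^ ('i \<times> 'j) \<Rightarrow> complex ^ ('j \<times> 'i)"
  where "braiding G V W =
    (THE F. clinear F \<and>
      (\<forall>x\<in>carrier G. \<forall>v\<in>component V x. \<forall>w. F (v \<otimes>\<^sub>v w) = action W x w \<otimes>\<^sub>v v))"

definition sigma1 ::
    "('a, 'b) monoid_scheme \<Rightarrow> ('a, 'i::finite) graded_rep \<Rightarrow> ('a, 'j::finite) graded_rep
      \<Rightarrow> complex ^ (('i \<times> 'j) \<times> 'l::finite) \<Rightarrow> complex ^ (('j \<times> 'i) \<times> 'l)"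
  where "sigma1 G U V = tensor_map (braiding G U V) id"

definition sigma2 ::
    "('a, 'b) monoid_scheme \<Rightarrow> ('a \<Rightarrow> 'a \<Rightarrow> 'a \<Rightarrow> complex)
      \<Rightarrow> ('a, 'i::finite) graded_rep \<Rightarrow> ('a, 'j::finite) graded_rep \<Rightarrow> ('a, 'l::finite) graded_rep
      \<Rightarrow> complex ^ (('i \<times> 'j) \<times> 'l) \<Rightarrow> complex ^ (('i \<times> 'l) \<times> 'j)"
  where "sigma2 G \<omega> U V W =
    inv_into UNIV (associator G \<omega> U W V) \<circ> tensor_map id (braiding G V W) \<circ> associator G \<omega> U V W"

definition borromean_braid ::
    "('a, 'b) monoid_scheme \<Rightarrow> ('a \<Rightarrow> 'a \<Rightarrow> 'a \<Rightarrow> complex)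
      \<Rightarrow> ('a, 'i::finite) graded_rep \<Rightarrow> ('a, 'j::finite) graded_rep \<Rightarrow> ('a, 'l::finite) graded_rep
      \<Rightarrow> complex ^ (('i \<times> 'j) \<times> 'l) \<Rightarrow> complex ^ (('i \<times> 'j) \<times> 'l)"
  where "borromean_braid G \<omega> U V W =
    inv_into UNIV (sigma2 G \<omega> U V W) \<circ> sigma1 G W U \<circ>
    inv_into UNIV (sigma2 G \<omega> W U V) \<circ> sigma1 G V W \<circ>
    inv_into UNIV (sigma2 G \<omega> V W U) \<circ> sigma1 G U V"

definition borromean_tensor ::
    "('a, 'b) monoid_scheme \<Rightarrow> ('a \<Rightarrow> 'a \<Rightarrow> 'a \<Rightarrow> complex)
      \<Rightarrow> ('a, 'i::finite) graded_rep \<Rightarrow> ('a, 'j::finite) graded_rep \<Rightarrow> ('a, 'l::finite) graded_rep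
      \<Rightarrow> complex"
  where "borromean_tensor G \<omega> U V W = trace (matrix (borromean_braid G \<omega> U V W))"

definition borromean_cond :: "('a, 'b) monoid_scheme \<Rightarrow> 'a \<Rightarrow> 'a \<Rightarrow> 'a \<Rightarrow> bool"
  where "borromean_cond G x y z \<longleftrightarrow>
    \<lbrakk>\<lbrakk>inv\<^bsub>G\<^esub> y, x\<rbrakk>\<^bsub>G\<^esub>, z\<rbrakk>\<^bsub>G\<^esub> = \<one>\<^bsub>G\<^esub> \<and>
    \<lbrakk>\<lbrakk>z, y\<rbrakk>\<^bsub>G\<^esub>, x\<rbrakk>\<^bsub>G\<^esub> = \<one>\<^bsub>G\<^esub> \<and>
    \<lbrakk>\<lbrakk>inv\<^bsub>G\<^esub> z, inv\<^bsub>G\<^esub> x\<rbrakk>\<^bsub>G\<^esub>, y\<rbrakk>\<^bsub>G\<^esub> = \<one>\<^bsub>G\<^esub>"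

text \<open>
  \<open>\<sigma>\<^sub>2\<^sup>-\<^sup>1 \<sigma>\<^sub>1\<close> sends \<open>(u \<otimes> v) \<otimes> w\<close>, with degrees \<open>x, y, z\<close>, to
  \<open>\<psi>(x, z\<^sup>-\<^sup>1\<triangleright>x, x\<triangleright>y, z) (x\<triangleright>v \<otimes> w) \<otimes> z\<^sup>-\<^sup>1\<triangleright>u\<close>.
\<close>
definition psi ::
    "('a, 'b) monoid_scheme \<Rightarrow> ('a \<Rightarrow> 'a \<Rightarrow> 'a \<Rightarrow> complex) \<Rightarrow> 'a \<Rightarrow> 'a \<Rightarrow> 'a \<Rightarrow> 'a \<Rightarrow> complex"
  where "psi G \<omega> x x' y z =
    inverse (\<omega> y z x') * \<omega> y x z * inverse (alpha G \<omega> x z (inv\<^bsub>G\<^esub> z))"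

text \<open>
  After three steps \<open>u\<close>, \<open>v\<close>, \<open>w\<close> have become \<open>(y\<triangleright>z) \<triangleright> (z\<^sup>-\<^sup>1 \<triangleright> u)\<close>,
  \<open>(z\<^sup>-\<^sup>1\<triangleright>x\<^sup>-\<^sup>1) \<triangleright> (x \<triangleright> v)\<close> and \<open>y\<^sup>-\<^sup>1 \<triangleright> ((x\<triangleright>y) \<triangleright> w)\<close>. The last three factors of \<open>Omega\<close>
  combine each double action into the action of \<open>[y, z]\<close>, \<open>[z\<^sup>-\<^sup>1, x\<^sup>-\<^sup>1]\<close> and
  \<open>[y\<^sup>-\<^sup>1, x]\<close>, respectively.
\<close>
definition Omega ::
    "('a, 'b) monoid_scheme \<Rightarrow> ('a \<Rightarrow> 'a \<Rightarrow> 'a \<Rightarrow> complex) \<Rightarrow> 'a \<Rightarrow> 'a \<Rightarrow> 'a \<Rightarrow> complex"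
  where "Omega G \<omega> x y z =
    psi G \<omega> x (inv\<^bsub>G\<^esub> z \<triangleright>\<^bsub>G\<^esub> x) (x \<triangleright>\<^bsub>G\<^esub> y) z *
    psi G \<omega> (x \<triangleright>\<^bsub>G\<^esub> y) y (y \<triangleright>\<^bsub>G\<^esub> z) (inv\<^bsub>G\<^esub> z \<triangleright>\<^bsub>G\<^esub> x) *
    psi G \<omega> (y \<triangleright>\<^bsub>G\<^esub> z) z x y *
    (alpha G \<omega> x (y \<triangleright>\<^bsub>G\<^esub> z) (inv\<^bsub>G\<^esub> z) *
     alpha G \<omega> y (inv\<^bsub>G\<^esub> z \<triangleright>\<^bsub>G\<^esub> inv\<^bsub>G\<^esub> x) x *
     alpha G \<omega> z (inv\<^bsub>G\<^esub> y) (x \<triangleright>\<^bsub>G\<^esub> y))"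

end

theory Submission
  imports Defs
begin

text \<open>
  The braid is a threefold iteration of one elementary step, \<open>\<sigma>\<^sub>2\<^sup>-\<^sup>1 \<sigma>\<^sub>1\<close>, with the
  three factors permuted cyclically. On a tensor of homogeneous vectors the step acts by a scalar
  \<open>\<psi>\<close> and by two group actions (\<open>braid_step_tensor\<close>), so the whole braid maps the block of degree
  \<open>(x, y, z)\<close> into a single block, whose degree is read off from three applications of
  \<open>(x, y, z) \<mapsto> (x \<triangleright> y, z, z\<^sup>-\<^sup>1 \<triangleright> x)\<close>. Only blocks that are mapped to themselves contribute to the
  trace, and these are the blocks satisfying the commutator conditions
  (\<open>borromean_cond_conjugates\<close>, \<open>borromean_cond_if_fixed\<close>). On such a block the braid is \<open>\<Omega>(x, y, z)\<close>
  times a tensor product of three actions of centralizing elements, so its trace is the product of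
  \<open>\<Omega>\<close> and three projective characters (\<open>ltrace_block\<close>). This gives the sum over triples.

  Two facts reduce it to a sum over pairs. The product \<open>x y z\<close> is invariant under the step, so two
  of the three commutator conditions imply the third (\<open>borromean_cond_iff\<close>). And the contribution
  of a block does not change under simultaneous conjugation of \<open>x\<close>, \<open>y\<close>, \<open>z\<close> (\<open>summand_conjugate\<close>), so
  that \<open>z\<close> may be fixed to be \<open>k\<close>. Conceptually the invariance holds because the braid commutes with
  the action of each \<open>f\<close> on the triple tensor product. It is verified here on scalars: conjugating a
  step by \<open>f\<close> changes \<open>\<psi>\<close> by a quotient that telescopes over the three steps, and by factors that
  also measure how the characters change under transport
  (\<open>psi_conjugate\<close>, \<open>component_trace_conjugate\<close>, \<open>Omega_conjugate\<close>).

  The last two formulas parametrize the conjugacy classes by \<open>p \<mapsto> p \<triangleright> g\<close>, which is a bijection on a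
  transversal of the centralizer and has fibres of constant size on the whole group.
\<close>

section \<open>Conjugation, commutators and conjugacy classes\<close>


lemma bij_betw_Collect_image:
  "bij_betw f A B \<Longrightarrow> bij_betw f {a \<in> A. R (f a)} {b \<in> B. R b}"
  unfolding bij_betw_def inj_on_def by auto

context group begin

text \<open>
  Together with associativity and \<open>inv_mult_group\<close> these rules rewrite every group word to its reduced
  form, so identities between conjugates and commutators hold by simplification.
\<close>
lemma cancel_inv_left [simp]:
  "x \<in> carrier G \<Longrightarrow> y \<in> carrier G \<Longrightarrow> inv x \<otimes> (x \<otimes> y) = y"
  "x \<in> carrier G \<Longrightarrow> y \<in> carrier G \<Longrightarrow> x \<otimes> (inv x \<otimes> y) = y"
  by (simp_all flip: m_assoc)

lemma conjugate_closed [simp, intro]: "x \<in> carrier G \<Longrightarrow> y \<in> carrier G \<Longrightarrow> x \<triangleright> y \<in> carrier G"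
  by (simp add: conjugate_def)

lemma commutator_closed [simp, intro]: "x \<in> carrier G \<Longrightarrow> y \<in> carrier G \<Longrightarrow> \<lbrakk>x, y\<rbrakk> \<in> carrier G"
  by (simp add: commutator_def)

lemmas group_normal = conjugate_def commutator_def m_assoc inv_mult_group

lemma conjugate_one [simp]: "x \<in> carrier G \<Longrightarrow> \<one> \<triangleright> x = x" "x \<in> carrier G \<Longrightarrow> x \<triangleright> \<one> = \<one>"
  by (simp_all add: group_normal)

lemma conjugate_conjugate:
  "\<lbrakk>x \<in> carrier G; y \<in> carrier G; z \<in> carrier G\<rbrakk> \<Longrightarrow> x \<triangleright> (y \<triangleright> z) = (x \<otimes> y) \<triangleright> z"
  by (simp add: group_normal)

lemma conjugate_cancel [simp]:
  "x \<in> carrier G \<Longrightarrow> y \<in> carrier G \<Longrightarrow> inv x \<triangleright> (x \<triangleright> y) = y"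
  "x \<in> carrier G \<Longrightarrow> y \<in> carrier G \<Longrightarrow> x \<triangleright> (inv x \<triangleright> y) = y"
  by (simp_all add: group_normal)

lemma conjugate_mult:
  "\<lbrakk>x \<in> carrier G; y \<in> carrier G; z \<in> carrier G\<rbrakk> \<Longrightarrow> x \<triangleright> (y \<otimes> z) = (x \<triangleright> y) \<otimes> (x \<triangleright> z)"
  by (simp add: group_normal)

lemma conjugate_inv:
  "\<lbrakk>x \<in> carrier G; y \<in> carrier G\<rbrakk> \<Longrightarrow> x \<triangleright> inv y = inv (x \<triangleright> y)"
  by (simp add: group_normal)

lemma conjugate_mult_self:
  "\<lbrakk>x \<in> carrier G; y \<in> carrier G\<rbrakk> \<Longrightarrow> (x \<triangleright> y) \<otimes> x = x \<otimes> y"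
  by (simp add: group_normal)

lemma conjugate_distrib:
  "\<lbrakk>x \<in> carrier G; y \<in> carrier G; z \<in> carrier G\<rbrakk> \<Longrightarrow> x \<triangleright> (y \<triangleright> z) = (x \<triangleright> y) \<triangleright> (x \<triangleright> z)"
  by (simp add: group_normal)

lemma conjugate_commutator:
  "\<lbrakk>x \<in> carrier G; y \<in> carrier G; z \<in> carrier G\<rbrakk> \<Longrightarrow> x \<triangleright> \<lbrakk>y, z\<rbrakk> = \<lbrakk>x \<triangleright> y, x \<triangleright> z\<rbrakk>"
  by (simp add: group_normal)

lemma conjugate_eq_iff_commute:
  "\<lbrakk>x \<in> carrier G; y \<in> carrier G\<rbrakk> \<Longrightarrow> x \<triangleright> y = y \<longleftrightarrow> x \<otimes> y = y \<otimes> x"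
  by (metis conjugate_def conjugate_closed conjugate_mult_self inv_closed m_closed right_cancel)

lemma commutator_eq_one_iff:
  "\<lbrakk>x \<in> carrier G; y \<in> carrier G\<rbrakk> \<Longrightarrow> \<lbrakk>x, y\<rbrakk> = \<one> \<longleftrightarrow> x \<triangleright> y = y"
  by (metis commutator_def conjugate_closed conjugate_def inv_inv inv_closed inv_equality r_inv)

lemma centralizer_iff:
  "\<lbrakk>x \<in> carrier G; y \<in> carrier G\<rbrakk> \<Longrightarrow> x \<in> centralizer G y \<longleftrightarrow> x \<triangleright> y = y"
  by (auto simp: conjugate_eq_iff_commute centralizer_def)

lemma conj_class_carrier: "g \<in> carrier G \<Longrightarrow> conj_class G g \<subseteq> carrier G"
  by (auto simp: conj_class_def)

lemma conj_class_conjugate: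
  "\<lbrakk>f \<in> carrier G; g \<in> carrier G; x \<in> conj_class G g\<rbrakk> \<Longrightarrow> f \<triangleright> x \<in> conj_class G g"
  by (auto simp: conj_class_def conjugate_conjugate)

text \<open>
  Two elements conjugate \<open>g\<close> to the same element exactly when they lie in the same left coset of the
  centralizer.
\<close>
lemma transversal_bij:
  assumes g [simp]: "g \<in> carrier G" and P: "left_transversal G (centralizer G g) P"
  shows "bij_betw (\<lambda>p. p \<triangleright> g) P (conj_class G g)"
proof -
  have PG: "p \<in> carrier G" if "p \<in> P" for p
    using P that by (auto simp: left_transversal_def)
  have coset: "q \<in> p <# centralizer G g \<longleftrightarrow> p \<triangleright> g = q \<triangleright> g"
    if [simp]: "p \<in> carrier G" "q \<in> carrier G" for p q
  proof
    assume "q \<in> p <# centralizer G g"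
    then obtain c where "c \<in> carrier G" "c \<triangleright> g = g" "q = p \<otimes> c"
      by (auto simp: l_coset_def centralizer_iff) (auto simp: centralizer_def conjugate_eq_iff_commute)
    then show "p \<triangleright> g = q \<triangleright> g" by (metis conjugate_conjugate g that(1))
  next
    assume "p \<triangleright> g = q \<triangleright> g"
    then have "(inv p \<otimes> q) \<triangleright> g = g"
      by (metis conjugate_cancel(1) conjugate_conjugate g inv_closed that)
    then have "inv p \<otimes> q \<in> centralizer G g" by (simp add: centralizer_iff)
    then show "q \<in> p <# centralizer G g" by (force simp: l_coset_def)
  qed
  have ex1: "\<exists>!p. p \<in> P \<and> p \<in> f <# centralizer G g" if "f \<in> carrier G" for f
    using P that by (auto simp: left_transversal_def LCOSETS_def)
  show ?thesis
  proof (rule bij_betw_imageI)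
    show "inj_on (\<lambda>p. p \<triangleright> g) P"
      using ex1 coset PG by (intro inj_onI) metis
    show "(\<lambda>p. p \<triangleright> g) ` P = conj_class G g"
    proof
      show "(\<lambda>p. p \<triangleright> g) ` P \<subseteq> conj_class G g" using PG by (auto simp: conj_class_def)
      show "conj_class G g \<subseteq> (\<lambda>p. p \<triangleright> g) ` P"
      proof
        fix x assume "x \<in> conj_class G g"
        then obtain f where f: "f \<in> carrier G" "x = f \<triangleright> g" by (auto simp: conj_class_def)
        with ex1 obtain p where "p \<in> P" "p \<in> f <# centralizer G g" by blast
        with f coset PG show "x \<in> (\<lambda>p. p \<triangleright> g) ` P" by blast
      qed
    qed
  qed
qed

text \<open>
  All fibres of \<open>p \<mapsto> p \<triangleright> g\<close> have the same size, since they are translates of the centralizer of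
  \<open>g\<close>; the constant function \<open>1\<close> shows that this size is the order of the group divided by the size
  of the class.
\<close>
lemma sum_over_conjugators:
  fixes \<phi> :: "'a \<Rightarrow> complex"
  assumes fin: "finite (carrier G)" and g [simp]: "g \<in> carrier G"
  shows "of_nat (card (conj_class G g)) * (\<Sum>p\<in>carrier G. \<phi> (p \<triangleright> g)) =
    of_nat (order G) * (\<Sum>x\<in>conj_class G g. \<phi> x)"
proof -
  let ?F = "\<lambda>x. {p \<in> carrier G. p \<triangleright> g = x}"
  have card: "card (?F x) = card (?F g)" if x: "x \<in> conj_class G g" for x
  proof -
    obtain f where f [simp]: "f \<in> carrier G" and x: "x = f \<triangleright> g"
      using x by (auto simp: conj_class_def)
    have "bij_betw (\<lambda>p. inv f \<otimes> p) (?F x) (?F g)"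
      by (rule bij_betw_byWitness[where f' = "\<lambda>p. f \<otimes> p"])
        (auto simp: x simp flip: conjugate_conjugate)
    then show ?thesis by (rule bij_betw_same_card)
  qed
  have N: "(\<Sum>p\<in>carrier G. \<phi> (p \<triangleright> g)) = of_nat (card (?F g)) * (\<Sum>x\<in>conj_class G g. \<phi> x)"
    for \<phi> :: "'a \<Rightarrow> complex"
  proof -
    have "(\<Sum>p\<in>carrier G. \<phi> (p \<triangleright> g)) = (\<Sum>x\<in>conj_class G g. \<Sum>p\<in>?F x. \<phi> (p \<triangleright> g))"
      unfolding conj_class_def by (rule sum.image_gen[OF fin])
    also have "\<dots> = (\<Sum>x\<in>conj_class G g. of_nat (card (?F g)) * \<phi> x)"
      by (rule sum.cong) (simp_all flip: card)
    finally show ?thesis by (simp add: sum_distrib_left)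
  qed
  have "of_nat (order G) = (of_nat (card (?F g)) * of_nat (card (conj_class G g)) :: complex)"
    using N[of "\<lambda>_. 1"] by (simp add: order_def)
  then show ?thesis by (simp add: N)
qed

end

section \<open>The multiplier alpha and its behaviour under conjugation\<close>

locale cocycle_group = group G for G (structure) +
  fixes \<omega> :: "'a \<Rightarrow> 'a \<Rightarrow> 'a \<Rightarrow> complex"
  assumes fin: "finite (carrier G)" and cocycle: "normalized_3cocycle G \<omega>"

context cocycle_group begin

lemma cocycle_nonzero [simp]:
  "\<lbrakk>a \<in> carrier G; b \<in> carrier G; c \<in> carrier G\<rbrakk> \<Longrightarrow> \<omega> a b c \<noteq> 0"
  using cocycle by (simp add: normalized_3cocycle_def)

lemma cocycle_one [simp]:
  "\<lbrakk>a \<in> carrier G; b \<in> carrier G\<rbrakk> \<Longrightarrow> \<omega> \<one> a b = 1"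
  "\<lbrakk>a \<in> carrier G; b \<in> carrier G\<rbrakk> \<Longrightarrow> \<omega> a \<one> b = 1"
  "\<lbrakk>a \<in> carrier G; b \<in> carrier G\<rbrakk> \<Longrightarrow> \<omega> a b \<one> = 1"
  using cocycle by (simp_all add: normalized_3cocycle_def)

text \<open>
  In quotient form the instances of the 3-cocycle identity can be multiplied together: an identity
  between monomials in the values of \<open>\<omega>\<close> follows once the quotient of its sides is written as a
  product of such quotients.
\<close>
lemma cocycle_identity:
  "\<lbrakk>a \<in> carrier G; b \<in> carrier G; c \<in> carrier G; d \<in> carrier G\<rbrakk> \<Longrightarrow>
    \<omega> b c d * \<omega> a (b \<otimes> c) d * \<omega> a b c / (\<omega> (a \<otimes> b) c d * \<omega> a b (c \<otimes> d)) = 1"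
  using cocycle by (simp add: normalized_3cocycle_def)

lemma alpha_nonzero [simp]:
  "\<lbrakk>g \<in> carrier G; a \<in> carrier G; b \<in> carrier G\<rbrakk> \<Longrightarrow> alpha G \<omega> g a b \<noteq> 0"
  by (simp add: alpha_def)

lemma alpha_one [simp]:
  "\<lbrakk>g \<in> carrier G; a \<in> carrier G\<rbrakk> \<Longrightarrow> alpha G \<omega> g \<one> a = 1"
  "\<lbrakk>g \<in> carrier G; a \<in> carrier G\<rbrakk> \<Longrightarrow> alpha G \<omega> g a \<one> = 1"
  by (simp_all add: alpha_def)

text \<open>
  Both bracketings of \<open>a \<triangleright> (b \<triangleright> (c \<triangleright> w))\<close> reduce to the action of \<open>a b c\<close> on \<open>w\<close>. As an identity of
  cochains this is a product of four 3-cocycle identities, in which the argument \<open>g\<close> moves to the left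
  past \<open>c\<close>, \<open>b\<close> and \<open>a\<close> in turn, being conjugated on the way.
\<close>
lemma alpha_cocycle:
  assumes [simp]: "g \<in> carrier G" "a \<in> carrier G" "b \<in> carrier G" "c \<in> carrier G"
  shows "alpha G \<omega> (c \<triangleright> g) a b * alpha G \<omega> g (a \<otimes> b) c =
    alpha G \<omega> g b c * alpha G \<omega> g a (b \<otimes> c)"
proof -
  let ?\<delta> = "\<lambda>a b c d. \<omega> b c d * \<omega> a (b \<otimes> c) d * \<omega> a b c / (\<omega> (a \<otimes> b) c d * \<omega> a b (c \<otimes> d))"
  define x where "x = c \<triangleright> g"
  define y where "y = (b \<otimes> c) \<triangleright> g"
  define z where "z = (a \<otimes> (b \<otimes> c)) \<triangleright> g"
  have [simp]: "x \<in> carrier G" "y \<in> carrier G" "z \<in> carrier G"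
    by (simp_all add: x_def y_def z_def)
  have eqs: "c \<otimes> g = x \<otimes> c" "b \<otimes> x = y \<otimes> b" "a \<otimes> y = z \<otimes> a"
    "(a \<otimes> b) \<triangleright> x = z" "b \<triangleright> x = y" "a \<otimes> b \<otimes> c = a \<otimes> (b \<otimes> c)"
    by (simp_all add: x_def y_def z_def group_normal)
  have \<delta>: "?\<delta> a b c g = 1" "?\<delta> a b x c = 1" "?\<delta> a y b c = 1" "?\<delta> z a b c = 1"
    by (simp_all only: cocycle_identity assms \<open>x \<in> carrier G\<close> \<open>y \<in> carrier G\<close> \<open>z \<in> carrier G\<close>)
  have "alpha G \<omega> x a b * alpha G \<omega> g (a \<otimes> b) c / (alpha G \<omega> g b c * alpha G \<omega> g a (b \<otimes> c)) =
    ?\<delta> a b c g * ?\<delta> a y b c / (?\<delta> a b x c * ?\<delta> z a b c)"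
    by (simp add: alpha_def eqs x_def[symmetric] y_def[symmetric] z_def[symmetric] divide_simps)
  then show ?thesis
    unfolding \<delta> by (simp add: x_def)
qed
lemma alpha_inverse:
  assumes [simp]: "g \<in> carrier G" "a \<in> carrier G"
  shows "alpha G \<omega> g a (inv a) = alpha G \<omega> (inv a \<triangleright> g) (inv a) a"
  using alpha_cocycle[of "inv a \<triangleright> g" a "inv a" a] by simp

text \<open>
  If \<open>w\<close> has degree \<open>x\<close>, then \<open>(f \<triangleright> a) \<triangleright> (f \<triangleright> w)\<close> is \<open>conj_ratio f x a\<close> times \<open>f \<triangleright> (a \<triangleright> w)\<close>: this
  scalar measures how far \<open>f\<close> is from intertwining the action of \<open>a\<close> with that of \<open>f \<triangleright> a\<close>.
\<close>
definition conj_ratio :: "'a \<Rightarrow> 'a \<Rightarrow> 'a \<Rightarrow> complex" where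
  "conj_ratio f x a = alpha G \<omega> x (f \<triangleright> a) f / alpha G \<omega> x f a"

text \<open>
  The scalar in the action on a tensor product in the center: \<open>f \<triangleright> (u \<otimes> v)\<close> is
  \<open>tensor_factor f x y\<close> times \<open>(f \<triangleright> u) \<otimes> (f \<triangleright> v)\<close> for \<open>u\<close>, \<open>v\<close> of degrees \<open>x\<close>, \<open>y\<close>. The other hexagon,
  for the braiding of an object of degree \<open>f\<close> past \<open>u \<otimes> v\<close>, determines it.
\<close>
definition tensor_factor :: "'a \<Rightarrow> 'a \<Rightarrow> 'a \<Rightarrow> complex" where
  "tensor_factor f x y = \<omega> (f \<triangleright> x) f y / (\<omega> f x y * \<omega> (f \<triangleright> x) (f \<triangleright> y) f)"

lemma conj_ratio_nonzero [simp]: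
  "\<lbrakk>f \<in> carrier G; x \<in> carrier G; a \<in> carrier G\<rbrakk> \<Longrightarrow> conj_ratio f x a \<noteq> 0"
  by (simp add: conj_ratio_def)

lemma tensor_factor_nonzero [simp]:
  "\<lbrakk>f \<in> carrier G; x \<in> carrier G; a \<in> carrier G\<rbrakk> \<Longrightarrow> tensor_factor f x a \<noteq> 0"
  by (simp add: tensor_factor_def)

lemma conj_ratio_one [simp]:
  "\<lbrakk>f \<in> carrier G; x \<in> carrier G\<rbrakk> \<Longrightarrow> conj_ratio f x \<one> = 1"
  by (simp add: conj_ratio_def)

text \<open>
  Compare two ways of moving \<open>f\<close> to the right past \<open>a\<close> and \<open>b\<close>: one at a time, or after combining
  them into \<open>a b\<close>.
\<close>
lemma conj_ratio_mult:
  assumes [simp]: "f \<in> carrier G" "x \<in> carrier G" "a \<in> carrier G" "b \<in> carrier G"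
  shows "alpha G \<omega> (f \<triangleright> x) (f \<triangleright> a) (f \<triangleright> b) * conj_ratio f x (a \<otimes> b) =
    alpha G \<omega> x a b * conj_ratio f (b \<triangleright> x) a * conj_ratio f x b"
proof -
  let ?A = "alpha G \<omega>"
  have 1: "?A (f \<triangleright> x) (f \<triangleright> a) (f \<triangleright> b) * ?A x (f \<triangleright> (a \<otimes> b)) f =
      ?A x (f \<triangleright> b) f * ?A x (f \<triangleright> a) (f \<otimes> b)"
    using alpha_cocycle[of x "f \<triangleright> a" "f \<triangleright> b" f] by (simp add: conjugate_mult conjugate_mult_self)
  have 2: "?A (b \<triangleright> x) (f \<triangleright> a) f * ?A x (f \<otimes> a) b = ?A x f b * ?A x (f \<triangleright> a) (f \<otimes> b)"
    using alpha_cocycle[of x "f \<triangleright> a" f b] by (simp add: conjugate_mult_self)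
  have 3: "?A (b \<triangleright> x) f a * ?A x (f \<otimes> a) b = ?A x a b * ?A x f (a \<otimes> b)"
    by (rule alpha_cocycle) simp_all
  have 4: "?A (b \<triangleright> x) (f \<triangleright> a) f = ?A x f b * ?A x (f \<triangleright> a) (f \<otimes> b) / ?A x (f \<otimes> a) b"
    "?A (b \<triangleright> x) f a = ?A x a b * ?A x f (a \<otimes> b) / ?A x (f \<otimes> a) b"
    "?A (f \<triangleright> x) (f \<triangleright> a) (f \<triangleright> b) =
       ?A x (f \<triangleright> b) f * ?A x (f \<triangleright> a) (f \<otimes> b) / ?A x (f \<triangleright> (a \<otimes> b)) f"
    using 1 2 3 by (simp_all add: eq_divide_eq)
  show ?thesis
    unfolding conj_ratio_def 4 by simp
qed

text \<open>
  The braiding \<open>u \<otimes> v \<mapsto> (x \<triangleright> v) \<otimes> u\<close> commutes with the action of \<open>f\<close>.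
\<close>
lemma tensor_factor_braiding:
  assumes [simp]: "f \<in> carrier G" "x \<in> carrier G" "y \<in> carrier G"
  shows "tensor_factor f (x \<triangleright> y) x = tensor_factor f x y * conj_ratio f y x"
proof -
  have "f \<triangleright> (x \<triangleright> y) = (f \<triangleright> x) \<triangleright> (f \<triangleright> y)" "((f \<triangleright> x) \<otimes> f) \<triangleright> y = (f \<triangleright> x) \<triangleright> (f \<triangleright> y)"
    "(f \<otimes> x) \<triangleright> y = (f \<triangleright> x) \<triangleright> (f \<triangleright> y)"
    by (simp_all add: group_normal)
  then show ?thesis
    by (simp add: tensor_factor_def conj_ratio_def alpha_def divide_simps)
qed

text \<open>
  The associativity isomorphism commutes with the action of \<open>f\<close>. The four 3-cocycle identities
  used come from moving \<open>f\<close> to the right past \<open>x\<close>, \<open>y\<close>, \<open>z\<close>, conjugating each of them.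
\<close>
lemma tensor_factor_associator:
  assumes [simp]: "f \<in> carrier G" "x \<in> carrier G" "y \<in> carrier G" "z \<in> carrier G"
  shows "tensor_factor f x y * tensor_factor f (x \<otimes> y) z * \<omega> (f \<triangleright> x) (f \<triangleright> y) (f \<triangleright> z) =
    \<omega> x y z * tensor_factor f y z * tensor_factor f x (y \<otimes> z)"
proof -
  let ?\<delta> = "\<lambda>a b c d. \<omega> b c d * \<omega> a (b \<otimes> c) d * \<omega> a b c / (\<omega> (a \<otimes> b) c d * \<omega> a b (c \<otimes> d))"
  define X Y Z where "X = f \<triangleright> x" and "Y = f \<triangleright> y" and "Z = f \<triangleright> z"
  have cl [simp]: "X \<in> carrier G" "Y \<in> carrier G" "Z \<in> carrier G"
    by (simp_all add: X_def Y_def Z_def)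
  have eqs: "f \<otimes> x = X \<otimes> f" "f \<otimes> y = Y \<otimes> f" "f \<otimes> z = Z \<otimes> f"
    "f \<triangleright> (x \<otimes> y) = X \<otimes> Y" "f \<triangleright> (y \<otimes> z) = Y \<otimes> Z" "f \<triangleright> x = X" "f \<triangleright> y = Y" "f \<triangleright> z = Z"
    by (simp_all add: X_def Y_def Z_def conjugate_mult_self conjugate_mult)
  have \<delta>: "?\<delta> f x y z = 1" "?\<delta> X f y z = 1" "?\<delta> X Y f z = 1" "?\<delta> X Y Z f = 1"
    by (simp_all only: cocycle_identity assms cl)
  have "tensor_factor f x y * tensor_factor f (x \<otimes> y) z * \<omega> X Y Z /
      (\<omega> x y z * tensor_factor f y z * tensor_factor f x (y \<otimes> z)) =
    ?\<delta> X f y z * ?\<delta> X Y Z f / (?\<delta> f x y z * ?\<delta> X Y f z)"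
    by (simp add: tensor_factor_def eqs divide_simps)
  then show ?thesis
    unfolding \<delta> by (simp add: eqs)
qed

text \<open>
  The scalar in the action of \<open>f\<close> on \<open>(u \<otimes> v) \<otimes> w\<close>.
\<close>
definition triple_factor :: "'a \<Rightarrow> 'a \<Rightarrow> 'a \<Rightarrow> 'a \<Rightarrow> complex" where
  "triple_factor f x y z = tensor_factor f x y * tensor_factor f (x \<otimes> y) z"

lemma triple_factor_nonzero [simp]:
  "\<lbrakk>f \<in> carrier G; x \<in> carrier G; y \<in> carrier G; z \<in> carrier G\<rbrakk> \<Longrightarrow> triple_factor f x y z \<noteq> 0"
  by (simp add: triple_factor_def)

lemma psi_nonzero [simp]:
  "\<lbrakk>x \<in> carrier G; x' \<in> carrier G; y \<in> carrier G; z \<in> carrier G\<rbrakk> \<Longrightarrow> psi G \<omega> x x' y z \<noteq> 0"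
  by (simp add: psi_def)

text \<open>
  The elementary step \<open>(u \<otimes> v) \<otimes> w \<mapsto> \<psi> ((x \<triangleright> v) \<otimes> w) \<otimes> (z\<^sup>-\<^sup>1 \<triangleright> u)\<close> commutes with the action of \<open>f\<close>.
  The factors \<open>triple_factor\<close> belong to the source and the target of the step, and the two factors
  \<open>conj_ratio\<close> to the actions on \<open>v\<close> and \<open>u\<close>.
\<close>
lemma psi_conjugate:
  assumes [simp]: "f \<in> carrier G" "x \<in> carrier G" "y \<in> carrier G" "z \<in> carrier G"
  assumes x': "x' = inv z \<triangleright> x" and y': "y' = x \<triangleright> y"
  shows "psi G \<omega> x x' y' z * triple_factor f y' z x' =
    triple_factor f x y z * psi G \<omega> (f \<triangleright> x) (f \<triangleright> x') (f \<triangleright> y') (f \<triangleright> z) * conj_ratio f y x * conj_ratio f x (inv z)"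
proof -
  have [simp]: "x' \<in> carrier G" "y' \<in> carrier G"
    by (simp_all add: x' y')
  have [simp]: "z \<triangleright> x' = x" "z \<otimes> x' = x \<otimes> z" "y' \<otimes> x = x \<otimes> y"
    by (simp_all add: x' y' conjugate_mult_self) (simp add: group_normal)
  let ?A = "alpha G \<omega>"
  have a1: "tensor_factor f y' x = tensor_factor f x y * conj_ratio f y x"
    unfolding y' by (rule tensor_factor_braiding) simp_all
  have a2: "tensor_factor f x z = tensor_factor f z x' * conj_ratio f x' z"
    using tensor_factor_braiding[of f z x'] by simp
  have b1: "tensor_factor f y' x * tensor_factor f (y' \<otimes> x) z * \<omega> (f \<triangleright> y') (f \<triangleright> x) (f \<triangleright> z) =
      \<omega> y' x z * tensor_factor f x z * tensor_factor f y' (x \<otimes> z)"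
    by (rule tensor_factor_associator) simp_all
  have b2: "tensor_factor f y' z * tensor_factor f (y' \<otimes> z) x' * \<omega> (f \<triangleright> y') (f \<triangleright> z) (f \<triangleright> x') =
      \<omega> y' z x' * tensor_factor f z x' * tensor_factor f y' (x \<otimes> z)"
    using tensor_factor_associator[of f y' z x'] by simp
  have c: "?A (f \<triangleright> x') (f \<triangleright> inv z) (f \<triangleright> z) = ?A x' (inv z) z * conj_ratio f x (inv z) * conj_ratio f x' z"
    using conj_ratio_mult[of f x' "inv z" z] by simp
  have p: "psi G \<omega> x x' y' z = \<omega> y' x z / (\<omega> y' z x' * ?A x' (inv z) z)"
    by (simp add: psi_def alpha_inverse x' divide_simps)
  have p': "psi G \<omega> (f \<triangleright> x) (f \<triangleright> x') (f \<triangleright> y') (f \<triangleright> z) =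
      \<omega> (f \<triangleright> y') (f \<triangleright> x) (f \<triangleright> z) /
        (\<omega> (f \<triangleright> y') (f \<triangleright> z) (f \<triangleright> x') * ?A (f \<triangleright> x') (f \<triangleright> inv z) (f \<triangleright> z))"
    using alpha_inverse[of "f \<triangleright> x" "f \<triangleright> z"]
    by (simp add: psi_def x' conjugate_distrib[of f "inv z"] conjugate_inv divide_simps)
  have b1': "tensor_factor f x y * conj_ratio f y x * tensor_factor f (x \<otimes> y) z * \<omega> (f \<triangleright> y') (f \<triangleright> x) (f \<triangleright> z) =
      \<omega> y' x z * tensor_factor f z x' * conj_ratio f x' z * tensor_factor f y' (x \<otimes> z)"
    using b1 by (simp add: a1 a2 mult.assoc)
  have "triple_factor f x y z * psi G \<omega> (f \<triangleright> x) (f \<triangleright> x') (f \<triangleright> y') (f \<triangleright> z) * conj_ratio f y x * conj_ratio f x (inv z) =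
     (tensor_factor f x y * conj_ratio f y x * tensor_factor f (x \<otimes> y) z * \<omega> (f \<triangleright> y') (f \<triangleright> x) (f \<triangleright> z)) *
      conj_ratio f x (inv z) / (\<omega> (f \<triangleright> y') (f \<triangleright> z) (f \<triangleright> x') * ?A (f \<triangleright> x') (f \<triangleright> inv z) (f \<triangleright> z))"
    by (simp add: triple_factor_def p')
  also have "\<dots> = (\<omega> y' z x' * tensor_factor f z x' * tensor_factor f y' (x \<otimes> z)) * \<omega> y' x z /
      (\<omega> y' z x' * \<omega> (f \<triangleright> y') (f \<triangleright> z) (f \<triangleright> x') * ?A x' (inv z) z)"
    by (simp add: b1' c divide_simps)
  also have "\<dots> = psi G \<omega> x x' y' z * triple_factor f y' z x'"
    unfolding b2[symmetric] by (simp add: p triple_factor_def divide_simps)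
  finally show ?thesis ..
qed

section \<open>The commutator conditions\<close>

lemma borromean_condD:
  assumes "borromean_cond G x y z" and [simp]: "x \<in> carrier G" "y \<in> carrier G" "z \<in> carrier G"
  shows "\<lbrakk>inv y, x\<rbrakk> \<triangleright> z = z" "\<lbrakk>z, y\<rbrakk> \<triangleright> x = x" "\<lbrakk>inv z, inv x\<rbrakk> \<triangleright> y = y" "\<lbrakk>y, z\<rbrakk> \<triangleright> x = x"
proof -
  show "\<lbrakk>inv y, x\<rbrakk> \<triangleright> z = z" "\<lbrakk>inv z, inv x\<rbrakk> \<triangleright> y = y" and 2: "\<lbrakk>z, y\<rbrakk> \<triangleright> x = x"
    using assms by (simp_all add: borromean_cond_def commutator_eq_one_iff)
  have "\<lbrakk>y, z\<rbrakk> = inv \<lbrakk>z, y\<rbrakk>" by (simp add: group_normal)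
  then show "\<lbrakk>y, z\<rbrakk> \<triangleright> x = x"
    using conjugate_cancel(1)[of "\<lbrakk>z, y\<rbrakk>" x] by (simp add: 2)
qed

lemma conjugate_eqD:
  assumes "a \<triangleright> x = x" "b \<otimes> a = c" and [simp]: "x \<in> carrier G" "a \<in> carrier G" "b \<in> carrier G"
  shows "c \<triangleright> x = b \<triangleright> x"
  by (metis assms conjugate_conjugate)

text \<open>
  Under the commutator conditions the degrees occurring after two and three steps simplify to those
  used in the definition of \<open>\<Omega>\<close>.
\<close>
lemma borromean_cond_conjugates:
  assumes c: "borromean_cond G x y z" and [simp]: "x \<in> carrier G" "y \<in> carrier G" "z \<in> carrier G"
  shows "(x \<triangleright> y) \<triangleright> z = y \<triangleright> z" "inv y \<triangleright> ((x \<triangleright> y) \<triangleright> z) = z"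
    "(y \<triangleright> z) \<triangleright> (inv z \<triangleright> x) = x"
    "inv (inv z \<triangleright> x) \<triangleright> (x \<triangleright> y) = y" "(inv z \<triangleright> x) \<triangleright> y = x \<triangleright> y"
proof -
  note d = borromean_condD[OF c]
  show 1: "(x \<triangleright> y) \<triangleright> z = y \<triangleright> z"
    using d(1) by (rule conjugate_eqD) (simp_all add: group_normal)
  then show "inv y \<triangleright> ((x \<triangleright> y) \<triangleright> z) = z" by simp
  have "(y \<triangleright> z) \<triangleright> (inv z \<triangleright> x) = inv \<lbrakk>z, y\<rbrakk> \<triangleright> x"
    by (simp add: group_normal)
  also have "\<dots> = inv \<lbrakk>z, y\<rbrakk> \<triangleright> (\<lbrakk>z, y\<rbrakk> \<triangleright> x)" using d(2) by simp
  finally show "(y \<triangleright> z) \<triangleright> (inv z \<triangleright> x) = x" by simp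
  have "inv (inv z \<triangleright> x) \<triangleright> (x \<triangleright> y) = \<lbrakk>inv z, inv x\<rbrakk> \<triangleright> y"
    by (simp add: group_normal)
  then show 2: "inv (inv z \<triangleright> x) \<triangleright> (x \<triangleright> y) = y" using d(3) by simp
  have "(inv z \<triangleright> x) \<triangleright> (inv (inv z \<triangleright> x) \<triangleright> (x \<triangleright> y)) = x \<triangleright> y" by simp
  then show "(inv z \<triangleright> x) \<triangleright> y = x \<triangleright> y" by (simp only: 2)
qed

text \<open>
  The hypotheses say that the three components of the third iterate of
  \<open>(x, y, z) \<mapsto> (x \<triangleright> y, z, z\<^sup>-\<^sup>1 \<triangleright> x)\<close> are \<open>x\<close>, \<open>y\<close> and \<open>z\<close> again.
\<close>
lemma borromean_cond_if_fixed:
  assumes [simp]: "x \<in> carrier G" "y \<in> carrier G" "z \<in> carrier G"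
  assumes 1: "((x \<triangleright> y) \<triangleright> z) \<triangleright> (inv z \<triangleright> x) = x" and 2: "inv (inv z \<triangleright> x) \<triangleright> (x \<triangleright> y) = y"
    and 3: "inv (inv (inv z \<triangleright> x) \<triangleright> (x \<triangleright> y)) \<triangleright> ((x \<triangleright> y) \<triangleright> z) = z"
  shows "borromean_cond G x y z"
proof -
  have y: "inv y \<triangleright> ((x \<triangleright> y) \<triangleright> z) = z"
    using 3 by (simp only: 2)
  then have z: "(x \<triangleright> y) \<triangleright> z = y \<triangleright> z"
    by (metis assms(1-3) conjugate_cancel(2) conjugate_closed)
  have "\<lbrakk>inv y, x\<rbrakk> \<triangleright> z = inv y \<triangleright> ((x \<triangleright> y) \<triangleright> z)"
    by (simp add: group_normal)
  then have a: "\<lbrakk>inv y, x\<rbrakk> \<triangleright> z = z" using y by simp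
  have "\<lbrakk>z, y\<rbrakk> \<triangleright> x = \<lbrakk>z, y\<rbrakk> \<triangleright> ((y \<triangleright> z) \<triangleright> (inv z \<triangleright> x))"
    using 1 by (simp only: z)
  also have "\<dots> = x" by (simp add: group_normal)
  finally have b: "\<lbrakk>z, y\<rbrakk> \<triangleright> x = x" .
  have "inv (inv z \<triangleright> x) \<triangleright> (x \<triangleright> y) = \<lbrakk>inv z, inv x\<rbrakk> \<triangleright> y"
    by (simp add: group_normal)
  then show ?thesis using 2 a b
    by (simp add: borromean_cond_def commutator_eq_one_iff)
qed

text \<open>
  The degree map \<open>(x, y, z) \<mapsto> (x \<triangleright> y, z, z\<^sup>-\<^sup>1 \<triangleright> x)\<close> preserves the product \<open>x y z\<close>. So once two components
  of its third iterate are known, the remaining one follows.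
\<close>
lemma borromean_cond_iff:
  assumes [simp]: "x \<in> carrier G" "y \<in> carrier G" "z \<in> carrier G"
  shows "borromean_cond G x y z \<longleftrightarrow> \<lbrakk>\<lbrakk>z, y\<rbrakk>, x\<rbrakk> = \<one> \<and> \<lbrakk>\<lbrakk>inv y, x\<rbrakk>, z\<rbrakk> = \<one>"
proof
  assume "\<lbrakk>\<lbrakk>z, y\<rbrakk>, x\<rbrakk> = \<one> \<and> \<lbrakk>\<lbrakk>inv y, x\<rbrakk>, z\<rbrakk> = \<one>"
  then have d: "\<lbrakk>inv y, x\<rbrakk> \<triangleright> z = z" "\<lbrakk>z, y\<rbrakk> \<triangleright> x = x"
    by (simp_all add: commutator_eq_one_iff)
  define A B C where "A = (x \<triangleright> y) \<triangleright> z" and "B = inv z \<triangleright> x" and "C = inv (inv z \<triangleright> x) \<triangleright> (x \<triangleright> y)"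
  have [simp]: "A \<in> carrier G" "B \<in> carrier G" "C \<in> carrier G"
    by (simp_all add: A_def B_def C_def)
  have A: "A = y \<triangleright> z"
    unfolding A_def using d(1) by (rule conjugate_eqD) (simp_all add: group_normal)
  have "A \<triangleright> B = inv \<lbrakk>z, y\<rbrakk> \<triangleright> (\<lbrakk>z, y\<rbrakk> \<triangleright> x)"
    unfolding d(2) by (simp add: A B_def group_normal)
  then have AB: "A \<triangleright> B = x" by simp
  \<comment> \<open>After two steps the degrees are \<open>A\<close>, \<open>B\<close>, \<open>C\<close>; their product is still \<open>x y z\<close>.\<close>
  have "A \<otimes> (B \<otimes> C) = x \<otimes> (y \<otimes> z)"
    by (simp add: A_def B_def C_def group_normal)
  moreover have "A \<otimes> (B \<otimes> C) = (A \<triangleright> B) \<otimes> (A \<otimes> C)"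
    by (simp add: group_normal)
  ultimately have "A \<otimes> C = y \<otimes> z"
    by (simp add: AB)
  also have "y \<otimes> z = A \<otimes> y" by (simp add: A conjugate_mult_self)
  finally have C: "C = y" by simp
  show "borromean_cond G x y z"
  proof (rule borromean_cond_if_fixed)
    show "((x \<triangleright> y) \<triangleright> z) \<triangleright> (inv z \<triangleright> x) = x" using AB by (simp add: A_def B_def)
    show "inv (inv z \<triangleright> x) \<triangleright> (x \<triangleright> y) = y" using C by (simp add: C_def)
    have "inv C \<triangleright> A = z" by (simp add: C A)
    then show "inv (inv (inv z \<triangleright> x) \<triangleright> (x \<triangleright> y)) \<triangleright> ((x \<triangleright> y) \<triangleright> z) = z" by (simp add: C_def A_def)
  qed simp_all
qed (simp add: borromean_cond_def)

lemma borromean_cond_conjugate: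
  assumes "borromean_cond G x y z"
    and [simp]: "f \<in> carrier G" "x \<in> carrier G" "y \<in> carrier G" "z \<in> carrier G"
  shows "borromean_cond G (f \<triangleright> x) (f \<triangleright> y) (f \<triangleright> z)"
  using assms(1) by (simp add: borromean_cond_def flip: conjugate_commutator conjugate_inv)

text \<open>
  Multiplying \<open>psi_conjugate\<close> over the three steps, the factors \<open>triple_factor\<close> cancel cyclically,
  because the degrees return to \<open>(x, y, z)\<close>. The six remaining factors \<open>conj_ratio\<close> combine in pairs,
  one pair for each of \<open>u\<close>, \<open>v\<close>, \<open>w\<close>, by \<open>conj_ratio_mult\<close>.
\<close>
lemma Omega_conjugate:
  assumes c: "borromean_cond G x y z"
    and [simp]: "f \<in> carrier G" "x \<in> carrier G" "y \<in> carrier G" "z \<in> carrier G"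
  shows "Omega G \<omega> (f \<triangleright> x) (f \<triangleright> y) (f \<triangleright> z) *
      (conj_ratio f x \<lbrakk>y, z\<rbrakk> * conj_ratio f y \<lbrakk>inv z, inv x\<rbrakk> * conj_ratio f z \<lbrakk>inv y, x\<rbrakk>) = Omega G \<omega> x y z"
proof -
  note d = borromean_cond_conjugates[OF c]
  define x' y' z' where "x' = inv z \<triangleright> x" and "y' = x \<triangleright> y" and "z' = y \<triangleright> z"
  have [simp]: "x' \<in> carrier G" "y' \<in> carrier G" "z' \<in> carrier G"
    by (simp_all add: x'_def y'_def z'_def)
  have e: "y' \<triangleright> z = z'" "inv y \<triangleright> z' = z" "z' \<triangleright> x' = x" "inv x' \<triangleright> y' = y" "x' \<triangleright> y = y'"
    using d by (simp_all add: x'_def y'_def z'_def)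
  have ix': "inv z \<triangleright> inv x = inv x'" by (simp add: x'_def conjugate_inv)
  let ?A = "alpha G \<omega>" and ?f = "\<lambda>a. f \<triangleright> a" and ?P = "psi G \<omega>"
  have fe: "inv (?f x) = ?f (inv x)" "inv (?f x') = ?f (inv x')" "inv (?f y) = ?f (inv y)"
    "inv (?f z) = ?f (inv z)" "?f x \<triangleright> ?f y = ?f y'" "?f y \<triangleright> ?f z = ?f z'"
    "?f (inv z) \<triangleright> ?f x = ?f x'" "?f (inv z) \<triangleright> ?f (inv x) = ?f (inv x')"
    unfolding x'_def y'_def z'_def by (simp_all flip: conjugate_inv conjugate_distrib)
  have 1: "?P x x' y' z * triple_factor f y' z x' =
      triple_factor f x y z * ?P (?f x) (?f x') (?f y') (?f z) * conj_ratio f y x * conj_ratio f x (inv z)"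
    by (rule psi_conjugate) (simp_all add: x'_def y'_def)
  have 2: "?P y' y z' x' * triple_factor f z' x' y =
      triple_factor f y' z x' * ?P (?f y') (?f y) (?f z') (?f x') * conj_ratio f z y' * conj_ratio f y' (inv x')"
    by (rule psi_conjugate) (simp_all add: e)
  have 3: "?P z' z x y * triple_factor f x y z =
      triple_factor f z' x' y * ?P (?f z') (?f z) (?f x) (?f y) * conj_ratio f x' z' * conj_ratio f z' (inv y)"
    by (rule psi_conjugate) (simp_all add: e)
  have b1: "?A (?f x) (?f z') (?f (inv z)) * conj_ratio f x \<lbrakk>y, z\<rbrakk> =
      ?A x z' (inv z) * conj_ratio f x' z' * conj_ratio f x (inv z)"
    using conj_ratio_mult[of f x z' "inv z"]
    by (simp add: x'_def[symmetric]) (simp add: z'_def group_normal)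
  have b2: "?A (?f y) (?f (inv x')) (?f x) * conj_ratio f y \<lbrakk>inv z, inv x\<rbrakk> =
      ?A y (inv x') x * conj_ratio f y' (inv x') * conj_ratio f y x"
    using conj_ratio_mult[of f y "inv x'" x]
    by (simp add: y'_def[symmetric]) (simp add: x'_def group_normal)
  have b3: "?A (?f z) (?f (inv y)) (?f y') * conj_ratio f z \<lbrakk>inv y, x\<rbrakk> =
      ?A z (inv y) y' * conj_ratio f z' (inv y) * conj_ratio f z y'"
    using conj_ratio_mult[of f z "inv y" y']
    by (simp add: e(1)) (simp add: y'_def group_normal)
  have "Omega G \<omega> (f \<triangleright> x) (f \<triangleright> y) (f \<triangleright> z) *
      (conj_ratio f x \<lbrakk>y, z\<rbrakk> * conj_ratio f y \<lbrakk>inv z, inv x\<rbrakk> * conj_ratio f z \<lbrakk>inv y, x\<rbrakk>) =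
    ?P (?f x) (?f x') (?f y') (?f z) * ?P (?f y') (?f y) (?f z') (?f x') *
    ?P (?f z') (?f z) (?f x) (?f y) *
    ((?A (?f x) (?f z') (?f (inv z)) * conj_ratio f x \<lbrakk>y, z\<rbrakk>) *
     (?A (?f y) (?f (inv x')) (?f x) * conj_ratio f y \<lbrakk>inv z, inv x\<rbrakk>) *
     (?A (?f z) (?f (inv y)) (?f y') * conj_ratio f z \<lbrakk>inv y, x\<rbrakk>))"
    by (simp add: Omega_def fe mult_ac)
  also have "\<dots> = 
    (triple_factor f x y z * ?P (?f x) (?f x') (?f y') (?f z) * conj_ratio f y x * conj_ratio f x (inv z)) *
    (triple_factor f y' z x' * ?P (?f y') (?f y) (?f z') (?f x') * conj_ratio f z y' * conj_ratio f y' (inv x')) *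
    (triple_factor f z' x' y * ?P (?f z') (?f z) (?f x) (?f y) * conj_ratio f x' z' * conj_ratio f z' (inv y)) *
    (?A x z' (inv z) * ?A y (inv x') x * ?A z (inv y) y') / 
    (triple_factor f x y z * triple_factor f y' z x' * triple_factor f z' x' y)"
    unfolding b1 b2 b3 by simp
  also have "\<dots> = ?P x x' y' z * ?P y' y z' x' * ?P z' z x y * 
     (?A x z' (inv z) * ?A y (inv x') x * ?A z (inv y) y')"
    unfolding 1[symmetric] 2[symmetric] 3[symmetric] by simp
  also have "\<dots> = Omega G \<omega> x y z"
    by (simp add: Omega_def x'_def y'_def z'_def conjugate_inv)
  finally show ?thesis .
qed

end

section \<open>Tensor products and traces of linear maps\<close>

lemma clinear_iff:
  fixes f :: "complex ^ 'n::finite \<Rightarrow> complex ^ 'm::finite"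
  shows "clinear f \<longleftrightarrow> (\<forall>v w. f (v + w) = f v + f w) \<and> (\<forall>c v. f (c *s v) = c *s f v)"
  by (simp add: Vector_Spaces.linear_iff vec.vector_space_axioms)

lemma clinear_simps:
  assumes "clinear f"
  shows "f (v + w) = f v + f w" "f (c *s v) = c *s f v" "f 0 = 0" "f (sum h A) = (\<Sum>a\<in>A. f (h a))"
  by (fact vec.linear_add[OF assms] vec.linear_scale[OF assms] vec.linear_0[OF assms] vec.linear_sum[OF assms])+

lemma clinear_id: "clinear id" "clinear (\<lambda>v. v)"
  by (simp_all add: clinear_iff)

lemma clinear_compose: "clinear f \<Longrightarrow> clinear g \<Longrightarrow> clinear (\<lambda>v. f (g v))"
  by (simp add: clinear_iff)

lemma clinear_comp: "clinear f \<Longrightarrow> clinear g \<Longrightarrow> clinear (f \<circ> g)"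
  by (simp add: clinear_iff)

lemma clinear_scale: "clinear f \<Longrightarrow> clinear (\<lambda>v. c *s f v)"
  by (simp add: clinear_iff vec.scale_right_distrib mult.commute)

lemma clinear_sum: "(\<And>i. i \<in> A \<Longrightarrow> clinear (f i)) \<Longrightarrow> clinear (\<lambda>v. \<Sum>i\<in>A. f i v)"
  by (simp add: clinear_iff sum.distrib vec.scale_sum_right)

lemma tensor_nth [simp]: "(v \<otimes>\<^sub>v w) $ p = v $ fst p * w $ snd p"
  by (simp add: tensor_def)

lemma clinear_tensor_left: "clinear (\<lambda>v. v \<otimes>\<^sub>v w)"
  by (simp add: clinear_iff vec_eq_iff ring_distribs)

lemma clinear_tensor_right: "clinear (\<lambda>w. v \<otimes>\<^sub>v w)"
  by (simp add: clinear_iff vec_eq_iff ring_distribs)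

lemmas tensor_left_simps [simp] = clinear_simps(2,3)[OF clinear_tensor_left]
lemmas tensor_right_simps [simp] = clinear_simps(2,3)[OF clinear_tensor_right]

lemma axis_tensor: "axis a 1 \<otimes>\<^sub>v axis b 1 = (axis (a, b) 1 :: complex ^ ('n::finite \<times> 'm::finite))"
  by (auto simp: vec_eq_iff axis_def)

lemma span_range_axis: "vec.span (range (\<lambda>a. axis a 1)) = (UNIV :: (complex ^ 'n::finite) set)"
  using span_cart_basis by (simp add: cart_basis_def full_SetCompr_eq)

lemma span_tensors:
  fixes S :: "(complex ^ 'n::finite) set" and T :: "(complex ^ 'm::finite) set"
  assumes S: "vec.span S = UNIV" and T: "vec.span T = UNIV"
  shows "vec.span {s \<otimes>\<^sub>v t | s t. s \<in> S \<and> t \<in> T} = UNIV" (is "vec.span ?R = _")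
proof -
  have 1: "s \<otimes>\<^sub>v w \<in> vec.span ?R" if "s \<in> S" for s w
  proof -
    have "w \<in> vec.span T" by (simp add: T)
    then show ?thesis
    proof (induction rule: vec.span_induct)
      case base
      show ?case
        using vec.linear_subspace_vimage[OF clinear_tensor_right vec.subspace_span]
        by (simp add: vimage_def)
    qed (use that in \<open>auto intro: vec.span_base\<close>)
  qed
  have 2: "v \<otimes>\<^sub>v w \<in> vec.span ?R" for v w
  proof -
    have "v \<in> vec.span S" by (simp add: S)
    then show ?thesis
    proof (induction rule: vec.span_induct)
      case base
      show ?case
        using vec.linear_subspace_vimage[OF clinear_tensor_left vec.subspace_span]
        by (simp add: vimage_def)
    qed (rule 1)
  qed
  have "range (\<lambda>p. axis p 1) \<subseteq> vec.span ?R"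
    using 2 by (auto simp flip: axis_tensor)
  then have "vec.span (range (\<lambda>p. axis p 1)) \<subseteq> vec.span ?R"
    by (rule vec.span_minimal) (rule vec.subspace_span)
  then show ?thesis by (simp add: span_range_axis top.extremum_unique)
qed

lemma clinear_eq_on_spanning:
  assumes "clinear F" "clinear F'" "vec.span S = UNIV" "\<And>s. s \<in> S \<Longrightarrow> F s = F' s"
  shows "F = F'"
  using vec.linear_eq_on[OF assms(1,2) _ assms(4)] assms(3) by blast

definition bilinear_extension ::
    "(complex ^ 'n::finite \<Rightarrow> complex ^ 'm::finite \<Rightarrow> complex ^ 'p::finite)
      \<Rightarrow> complex ^ ('n \<times> 'm) \<Rightarrow> complex ^ 'p"
  where "bilinear_extension \<beta> t = (\<Sum>a\<in>UNIV. \<Sum>b\<in>UNIV. t $ (a, b) *s \<beta> (axis a 1) (axis b 1))"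

lemma clinear_bilinear_extension: "clinear (bilinear_extension \<beta>)"
  by (simp add: clinear_iff bilinear_extension_def vec.scale_left_distrib sum.distrib
      vec.scale_sum_right)

lemma bilinear_extension_tensor:
  assumes l: "\<And>w. clinear (\<lambda>v. \<beta> v w)" and r: "\<And>v. clinear (\<beta> v)"
  shows "bilinear_extension \<beta> (v \<otimes>\<^sub>v w) = \<beta> v w"
proof -
  have "\<beta> v w = \<beta> (\<Sum>a\<in>UNIV. v $ a *s axis a 1) (\<Sum>b\<in>UNIV. w $ b *s axis b 1)"
    by (simp only: basis_expansion)
  also have "\<dots> = (\<Sum>a\<in>UNIV. v $ a *s \<beta> (axis a 1) (\<Sum>b\<in>UNIV. w $ b *s axis b 1))"
    by (simp add: clinear_simps[OF l] del: basis_expansion)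
  also have "\<dots> = (\<Sum>a\<in>UNIV. \<Sum>b\<in>UNIV. (v $ a * w $ b) *s \<beta> (axis a 1) (axis b 1))"
    by (simp add: clinear_simps[OF r] vec.scale_sum_right del: basis_expansion)
  finally show ?thesis by (simp add: bilinear_extension_def)
qed

text \<open>
  Evaluates the definite descriptions that define tensor products of maps, associators and
  braidings: it is enough to exhibit one linear map with the required values on a spanning set.
\<close>
lemma ex1_clinear_on_spanning:
  assumes "clinear F" "Q F" "vec.span S = UNIV"
    and "\<And>F'. clinear F' \<Longrightarrow> Q F' \<Longrightarrow> \<forall>s\<in>S. F' s = F s"
  shows "(THE F. clinear F \<and> Q F) = F"
proof (rule the_equality)
  fix F' assume "clinear F' \<and> Q F'"
  then show "F' = F"
    using clinear_eq_on_spanning[OF _ assms(1,3), of F'] assms(4) by blast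
qed (use assms in simp)

lemma tensor_map:
  assumes f: "clinear f" and g: "clinear g"
  shows clinear_tensor_map: "clinear (tensor_map f g)"
    and tensor_map_tensor: "tensor_map f g (v \<otimes>\<^sub>v w) = f v \<otimes>\<^sub>v g w"
proof -
  let ?F = "bilinear_extension (\<lambda>v w. f v \<otimes>\<^sub>v g w)"
  have t: "?F (v \<otimes>\<^sub>v w) = f v \<otimes>\<^sub>v g w" for v w
    by (intro bilinear_extension_tensor clinear_compose[OF clinear_tensor_left f]
        clinear_compose[OF clinear_tensor_right g])
  have "tensor_map f g = ?F"
    unfolding tensor_map_def
    by (rule ex1_clinear_on_spanning[OF _ _ span_tensors[of UNIV UNIV]])
      (use t in \<open>auto intro: clinear_bilinear_extension\<close>)
  then show "clinear (tensor_map f g)" "tensor_map f g (v \<otimes>\<^sub>v w) = f v \<otimes>\<^sub>v g w"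
    by (simp_all add: t clinear_bilinear_extension)
qed

abbreviation ltrace :: "(complex ^ 'n::finite \<Rightarrow> complex ^ 'n) \<Rightarrow> complex" where
  "ltrace f \<equiv> trace (matrix f)"

lemma ltrace_eq: "ltrace f = (\<Sum>a\<in>UNIV. f (axis a 1) $ a)"
  by (simp add: trace_def matrix_def)

lemma ltrace_sum: "ltrace (\<lambda>v. \<Sum>i\<in>A. f i v) = (\<Sum>i\<in>A. ltrace (f i))"
  by (simp add: ltrace_eq) (rule sum.swap)

lemma ltrace_scale: "ltrace (\<lambda>v. c *s f v) = c * ltrace f"
  by (simp add: ltrace_eq sum_distrib_left)

lemma ltrace_zero: "ltrace (\<lambda>v. 0) = 0"
  by (simp add: ltrace_eq)

lemma ltrace_commute:
  fixes f :: "complex ^ 'n::finite \<Rightarrow> complex ^ 'm::finite" and g :: "complex ^ 'm \<Rightarrow> complex ^ 'n"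
  assumes "clinear f" "clinear g"
  shows "ltrace (\<lambda>v. f (g v)) = ltrace (\<lambda>v. g (f v))"
proof -
  have "matrix (\<lambda>v. f (g v)) = matrix f ** matrix g" "matrix (\<lambda>v. g (f v)) = matrix g ** matrix f"
    using matrix_compose_gen[OF assms] matrix_compose_gen[OF assms(2,1)] by (simp_all add: comp_def)
  then show ?thesis
    using trace_mul_sym[of "matrix f" "matrix g"] by simp
qed

lemma ltrace_tensor_map:
  assumes "clinear f" "clinear g"
  shows "ltrace (tensor_map f g) = ltrace f * ltrace g"
proof -
  have "tensor_map f g (axis (a, b) 1) $ (a, b) = f (axis a 1) $ a * g (axis b 1) $ b" for a b
    by (simp only: tensor_map_tensor[OF assms] tensor_nth fst_conv snd_conv flip: axis_tensor)
  then have "tensor_map f g (axis p 1) $ p = f (axis (fst p) 1) $ fst p * g (axis (snd p) 1) $ snd p" for p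
    by (metis prod.collapse)
  then have "ltrace (tensor_map f g) =
      (\<Sum>p\<in>UNIV \<times> UNIV. f (axis (fst p) 1) $ fst p * g (axis (snd p) 1) $ snd p)"
    unfolding ltrace_eq UNIV_Times_UNIV by (intro sum.cong) simp_all
  also have "\<dots> = ltrace f * ltrace g"
    unfolding ltrace_eq sum_product sum.cartesian_product case_prod_unfold ..
  finally show ?thesis .
qed

text \<open>
  The dimensions agree, so surjectivity implies injectivity. This avoids constructing inverses of
  associators and braidings.
\<close>
lemma clinear_bij_if_range_spans:
  fixes F :: "complex ^ 'n::finite \<Rightarrow> complex ^ 'm::finite"
  assumes F: "clinear F" and card: "CARD('n) = CARD('m)"
    and S: "vec.span S = UNIV" "\<And>s. s \<in> S \<Longrightarrow> s \<in> range F"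
  shows "bij F"
proof -
  have "vec.subspace (range F)"
    using vec.linear_subspace_image[OF F vec.subspace_UNIV] .
  then have "vec.span S \<subseteq> range F"
    using S(2) by (intro vec.span_minimal) auto
  then have "surj F" using S(1) by auto
  moreover from this have "inj F"
    by (intro vec.linear_surjective_imp_injective[OF F]) (simp_all add: card vec.dim_UNIV card_cart_basis)
  ultimately show ?thesis by (simp add: bij_def)
qed

lemma in_range_if_scaled:
  assumes "clinear F" "F a = c *s b" "c \<noteq> 0"
  shows "b \<in> range F"
proof -
  have "F (inverse c *s a) = b" by (simp add: clinear_simps(2)[OF assms(1)] assms(2,3))
  then show ?thesis by (metis rangeI)
qed

lemma inv_clinear_bij:
  assumes F: "clinear F" and "bij F"
  shows clinear_inv: "clinear (inv_into UNIV F)"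
    and inv_clinear_scale: "F a = c *s b \<Longrightarrow> c \<noteq> 0 \<Longrightarrow> inv_into UNIV F b = inverse c *s a"
proof -
  have inj: "inj F" and surj: "surj F" using \<open>bij F\<close> by (auto simp: bij_def)
  have *: "inv_into UNIV F b = a" if "F a = b" for a b
    using inv_f_eq[OF inj that] .
  have F': "F (inv_into UNIV F b) = b" for b
    using surj by (simp add: surj_f_inv_f)
  show "clinear (inv_into UNIV F)"
    unfolding clinear_iff by (intro conjI allI *; simp add: clinear_simps(1,2)[OF F] F')
  show "inv_into UNIV F b = inverse c *s a" if "F a = c *s b" "c \<noteq> 0"
    by (rule *) (simp add: clinear_simps[OF F] that)
qed

section \<open>Graded spaces and objects of the center\<close>

lemma sum_eq_single:
  assumes "finite A" "a \<in> A" "\<And>b. b \<in> A \<Longrightarrow> b \<noteq> a \<Longrightarrow> f b = 0"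
  shows "sum f A = f a"
  using assms by (simp add: sum.remove[of A a] sum.neutral)

definition homogeneous :: "('a, 'b) monoid_scheme \<Rightarrow> ('a, 'n::finite) graded_rep \<Rightarrow> (complex ^ 'n) set" where
  "homogeneous G V = (\<Union>x\<in>carrier G. component V x)"

definition triple_tensors ::
    "(complex ^ 'i::finite) set \<Rightarrow> (complex ^ 'j::finite) set \<Rightarrow> (complex ^ 'l::finite) set
      \<Rightarrow> (complex ^ (('i \<times> 'j) \<times> 'l)) set"
  where "triple_tensors R S T = {t \<otimes>\<^sub>v w | t w. t \<in> {u \<otimes>\<^sub>v v | u v. u \<in> R \<and> v \<in> S} \<and> w \<in> T}"

lemma span_triple_tensors:
  "\<lbrakk>vec.span R = UNIV; vec.span S = UNIV; vec.span T = UNIV\<rbrakk> \<Longrightarrow>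
    vec.span (triple_tensors R S T) = UNIV"
  unfolding triple_tensors_def by (intro span_tensors)

lemma clinear_eq_on_triple_tensors:
  assumes "clinear F" "clinear F'"
    and "\<And>u v w. F ((u \<otimes>\<^sub>v v) \<otimes>\<^sub>v w) = F' ((u \<otimes>\<^sub>v v) \<otimes>\<^sub>v w)"
  shows "F = F'"
  by (rule clinear_eq_on_spanning[OF assms(1,2) span_triple_tensors[of UNIV UNIV UNIV]])
    (use assms(3) in \<open>auto simp: triple_tensors_def\<close>)

context cocycle_group begin

lemma ex_proj:
  assumes "grading G (component V)"
  shows "decomposition G (component V) v (THE c. decomposition G (component V) v c)"
  using assms theI'[of "decomposition G (component V) v"] by (simp add: grading_def)

lemma proj_mem: "grading G (component V) \<Longrightarrow> x \<in> carrier G \<Longrightarrow> proj G V x v \<in> component V x"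
  using ex_proj[of V v] by (auto simp: decomposition_def proj_def)

lemma sum_proj: "grading G (component V) \<Longrightarrow> (\<Sum>x\<in>carrier G. proj G V x v) = v"
  using ex_proj[of V v] by (auto simp: decomposition_def proj_def)

lemma proj_eqI:
  assumes V: "grading G (component V)" and "x \<in> carrier G"
    and "\<And>x. x \<in> carrier G \<Longrightarrow> c x \<in> component V x" and "v = (\<Sum>x\<in>carrier G. c x)"
  shows "proj G V x v = c x"
proof -
  have "decomposition G (component V) v (restrict c (carrier G))"
    using assms by (simp add: decomposition_def)
  with V have "(THE c. decomposition G (component V) v c) = restrict c (carrier G)"
    by (intro the1_equality) (simp_all add: grading_def)
  with \<open>x \<in> carrier G\<close> show ?thesis by (simp add: proj_def)
qed

lemma clinear_proj:
  assumes V: "grading G (component V)" and x: "x \<in> carrier G"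
  shows "clinear (proj G V x)"
proof -
  have S: "vec.subspace (component V y)" if "y \<in> carrier G" for y
    using V that by (simp add: grading_def)
  have "proj G V x (v + w) = proj G V x v + proj G V x w" for v w
    by (rule proj_eqI[OF V x])
      (simp_all add: S vec.subspace_add proj_mem V sum.distrib sum_proj)
  moreover have "proj G V x (c *s v) = c *s proj G V x v" for c v
    by (rule proj_eqI[OF V x])
      (simp_all add: S vec.subspace_scale proj_mem V sum_proj flip: vec.scale_sum_right)
  ultimately show ?thesis by (simp add: clinear_iff)
qed

lemma proj_homogeneous:
  assumes V: "grading G (component V)" and x: "x \<in> carrier G" and y: "y \<in> carrier G"
    and v: "v \<in> component V y"
  shows "proj G V x v = (if x = y then v else 0)"
proof (rule proj_eqI[OF V x])
  fix z assume "z \<in> carrier G"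
  then show "(if z = y then v else 0) \<in> component V z"
    using V v by (simp add: grading_def vec.subspace_0)
qed (simp add: y fin)

lemma proj_id:
  "grading G (component V) \<Longrightarrow> x \<in> carrier G \<Longrightarrow> v \<in> component V x \<Longrightarrow> proj G V x v = v"
  by (simp add: proj_homogeneous[of V x x])

lemma span_homogeneous:
  assumes V: "grading G (component V)"
  shows "vec.span (homogeneous G V) = UNIV"
proof -
  have "(\<Sum>x\<in>carrier G. proj G V x v) \<in> vec.span (homogeneous G V)" for v
    by (rule vec.span_sum, rule vec.span_base) (auto intro: proj_mem[OF V] simp: homogeneous_def)
  then show ?thesis by (auto simp: sum_proj[OF V])
qed

lemma center_objectD:
  assumes "center_object G \<omega> V"
  shows center_grading: "grading G (component V)"
    and clinear_action: "x \<in> carrier G \<Longrightarrow> clinear (action V x)"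
    and action_mem: "x \<in> carrier G \<Longrightarrow> y \<in> carrier G \<Longrightarrow> w \<in> component V y \<Longrightarrow>
      action V x w \<in> component V (x \<triangleright> y)"
    and action_one: "action V \<one> w = w"
    and action_action: "x \<in> carrier G \<Longrightarrow> y \<in> carrier G \<Longrightarrow> z \<in> carrier G \<Longrightarrow> w \<in> component V z \<Longrightarrow>
      action V x (action V y w) = alpha G \<omega> z x y *s action V (x \<otimes> y) w"
  using assms by (simp_all add: center_object_def)

text \<open>
  The action of \<open>f\<close> identifies the component of degree \<open>x\<close> with that of degree \<open>f \<triangleright> x\<close>, with inverse a
  multiple of the action of \<open>f\<^sup>-\<^sup>1\<close>. It carries the action of \<open>c\<close> to that of \<open>f \<triangleright> c\<close> up to the scalar
  \<open>conj_ratio f x c\<close>, and the trace is invariant under this identification.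
\<close>
lemma component_trace_conjugate:
  assumes V: "center_object G \<omega> V" and [simp]: "f \<in> carrier G" "x \<in> carrier G" "c \<in> carrier G"
    and c: "c \<triangleright> x = x"
  shows "component_trace G V (f \<triangleright> x) (f \<triangleright> c) = conj_ratio f x c * component_trace G V x c"
proof -
  note gr = center_grading[OF V] and act = clinear_action[OF V] and mem = action_mem[OF V]
  let ?y = "f \<triangleright> x" and ?d = "f \<triangleright> c"
  let ?p = "proj G V x" and ?q = "proj G V ?y" and ?a = "alpha G \<omega> (f \<triangleright> x) f (inv f)"
  have d': "?d \<in> carrier G" by simp
  have d: "?d \<triangleright> ?y = ?y" by (simp flip: conjugate_distrib add: c)
  have a: "?a = alpha G \<omega> x (inv f) f" by (simp add: alpha_inverse)
  have lp: "clinear ?p" "clinear ?q" by (simp_all add: clinear_proj gr)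
  \<comment> \<open>The projection to degree \<open>f \<triangleright> x\<close> factors through the component of degree \<open>x\<close>, so that cyclicity
    of the trace moves the computation there.\<close>
  have 1: "?q v = inverse ?a *s action V f (?p (action V (inv f) (?q v)))" for v
  proof -
    have q: "?q v \<in> component V ?y" by (simp add: proj_mem gr)
    from mem[OF _ _ q, of "inv f"]
    have "action V (inv f) (?q v) \<in> component V x" by simp
    then show ?thesis
      by (simp add: proj_id[OF gr] action_action[OF V _ _ _ q] action_one[OF V])
  qed
  have 2: "action V (inv f) (?q (action V ?d (action V f (?p v)))) =
      (?a * conj_ratio f x c) *s action V c (?p v)" for v
  proof -
    have p: "?p v \<in> component V x" by (simp add: proj_mem gr)
    have p': "action V f (?p v) \<in> component V ?y" by (simp add: p mem)
    have p'': "action V c (?p v) \<in> component V x" using mem[OF _ _ p, of c] by (simp add: c)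
    have "action V ?d (action V f (?p v)) \<in> component V ?y"
      using mem[OF _ _ p', of ?d] by (simp add: d)
    then have "?q (action V ?d (action V f (?p v))) = action V ?d (action V f (?p v))"
      by (simp add: proj_id[OF gr])
    also have "\<dots> = alpha G \<omega> x ?d f *s action V (f \<otimes> c) (?p v)"
      by (simp add: action_action[OF V _ _ _ p] conjugate_mult_self)
    also have "\<dots> = conj_ratio f x c *s action V f (action V c (?p v))"
      by (simp add: action_action[OF V _ _ _ p] conj_ratio_def)
    finally show ?thesis
      by (simp add: clinear_simps[OF act] action_action[OF V _ _ _ p''] action_one[OF V] a mult.commute)
  qed
  have 3: "action V ?d (?q v) = inverse ?a *s action V ?d (action V f (?p (action V (inv f) (?q v))))" for v
    using arg_cong[OF 1[of v], of "action V ?d"] by (simp only: clinear_simps(2)[OF act[OF d']])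
  have "component_trace G V ?y ?d =
      ltrace (\<lambda>v. inverse ?a *s action V ?d (action V f (?p (action V (inv f) (?q v)))))"
    unfolding component_trace_def by (rule arg_cong[where f = ltrace], rule ext, rule 3)
  also have "\<dots> = inverse ?a * ltrace (\<lambda>v. action V ?d (action V f (?p (action V (inv f) (?q v)))))"
    by (rule ltrace_scale)
  also have "ltrace (\<lambda>v. action V ?d (action V f (?p (action V (inv f) (?q v))))) =
      ltrace (\<lambda>v. action V (inv f) (?q (action V ?d (action V f (?p v)))))"
    by (rule ltrace_commute[OF clinear_compose[OF act[OF d'] clinear_compose[OF act lp(1)]]
          clinear_compose[OF act lp(2)]]) simp_all
  also have "\<dots> = (?a * conj_ratio f x c) * component_trace G V x c"
    by (simp only: 2 component_trace_def ltrace_scale)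
  finally show ?thesis by simp
qed

text \<open>
  The defining property is realised by the sum over all triples of degrees of the rebracketing map,
  scaled by \<open>\<omega>\<close>, composed with the homogeneous projections.
\<close>
lemma associator:
  assumes U: "center_object G \<omega> U" and V: "center_object G \<omega> V" and W: "center_object G \<omega> W"
  shows clinear_associator: "clinear (associator G \<omega> U V W)"
    and associator_tensor: "\<lbrakk>x \<in> carrier G; y \<in> carrier G; z \<in> carrier G;
      u \<in> component U x; v \<in> component V y; w \<in> component W z\<rbrakk> \<Longrightarrow>
      associator G \<omega> U V W ((u \<otimes>\<^sub>v v) \<otimes>\<^sub>v w) = \<omega> x y z *s (u \<otimes>\<^sub>v (v \<otimes>\<^sub>v w))"
    and bij_associator: "bij (associator G \<omega> U V W)"
proof -
  note gr = center_grading[OF U] center_grading[OF V] center_grading[OF W]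
  let ?r = "\<lambda>t. \<chi> p. t $ ((fst p, fst (snd p)), snd (snd p))"
  let ?P = "\<lambda>x y z. tensor_map (tensor_map (proj G U x) (proj G V y)) (proj G W z)"
  let ?F = "\<lambda>t. \<Sum>(x, y, z)\<in>carrier G \<times> carrier G \<times> carrier G. \<omega> x y z *s ?r (?P x y z t)"
  let ?Q = "\<lambda>F. \<forall>x\<in>carrier G. \<forall>y\<in>carrier G. \<forall>z\<in>carrier G.
       \<forall>u\<in>component U x. \<forall>v\<in>component V y. \<forall>w\<in>component W z.
         F ((u \<otimes>\<^sub>v v) \<otimes>\<^sub>v w) = \<omega> x y z *s (u \<otimes>\<^sub>v (v \<otimes>\<^sub>v w))"
  have r: "clinear ?r" by (simp add: clinear_iff vec_eq_iff)
  have lF: "clinear ?F"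
    by (auto intro!: clinear_sum clinear_scale clinear_compose[OF r] clinear_tensor_map clinear_proj gr
        simp: case_prod_unfold)
  have QF: "?Q ?F"
  proof (intro ballI)
    fix x y z u v w
    assume h: "x \<in> carrier G" "y \<in> carrier G" "z \<in> carrier G"
      "u \<in> component U x" "v \<in> component V y" "w \<in> component W z"
    have "?F ((u \<otimes>\<^sub>v v) \<otimes>\<^sub>v w) = \<omega> x y z *s ?r (?P x y z ((u \<otimes>\<^sub>v v) \<otimes>\<^sub>v w))"
      by (subst sum_eq_single[where a = "(x, y, z)"])
        (use h in \<open>auto simp: fin tensor_map_tensor clinear_tensor_map clinear_proj gr
          proj_homogeneous[OF gr(1) _ h(1,4)] proj_homogeneous[OF gr(2) _ h(2,5)]
          proj_homogeneous[OF gr(3) _ h(3,6)] vec_eq_iff split: if_splits\<close>)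
    also have "\<dots> = \<omega> x y z *s (u \<otimes>\<^sub>v (v \<otimes>\<^sub>v w))"
      using h by (simp add: tensor_map_tensor clinear_tensor_map clinear_proj gr
          proj_homogeneous[OF gr(1) _ h(1,4)] proj_homogeneous[OF gr(2) _ h(2,5)]
          proj_homogeneous[OF gr(3) _ h(3,6)] vec_eq_iff mult.assoc)
    finally show "?F ((u \<otimes>\<^sub>v v) \<otimes>\<^sub>v w) = \<omega> x y z *s (u \<otimes>\<^sub>v (v \<otimes>\<^sub>v w))" .
  qed
  have "associator G \<omega> U V W = ?F"
    unfolding associator_def
  proof (rule ex1_clinear_on_spanning[where Q = ?Q, OF lF QF])
    show "vec.span (triple_tensors (homogeneous G U) (homogeneous G V) (homogeneous G W)) = UNIV"
      by (intro span_triple_tensors span_homogeneous gr)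
    fix F' assume "?Q F'"
    with QF show "\<forall>s\<in>triple_tensors (homogeneous G U) (homogeneous G V) (homogeneous G W). F' s = ?F s"
      by (force simp: triple_tensors_def homogeneous_def)
  qed
  with lF QF show l: "clinear (associator G \<omega> U V W)"
    and *: "\<And>x y z u v w. \<lbrakk>x \<in> carrier G; y \<in> carrier G; z \<in> carrier G;
      u \<in> component U x; v \<in> component V y; w \<in> component W z\<rbrakk> \<Longrightarrow>
      associator G \<omega> U V W ((u \<otimes>\<^sub>v v) \<otimes>\<^sub>v w) = \<omega> x y z *s (u \<otimes>\<^sub>v (v \<otimes>\<^sub>v w))"
    by simp_all
  show "bij (associator G \<omega> U V W)"
  proof (rule clinear_bij_if_range_spans[OF l])
    let ?S = "{u \<otimes>\<^sub>v t | u t. u \<in> homogeneous G U \<and>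
      t \<in> {v \<otimes>\<^sub>v w | v w. v \<in> homogeneous G V \<and> w \<in> homogeneous G W}}"
    show "vec.span ?S = UNIV"
      by (intro span_tensors span_homogeneous gr)
    fix s assume "s \<in> ?S"
    then obtain x y z u v w where h: "x \<in> carrier G" "y \<in> carrier G" "z \<in> carrier G"
      "u \<in> component U x" "v \<in> component V y" "w \<in> component W z" and s: "s = u \<otimes>\<^sub>v (v \<otimes>\<^sub>v w)"
      by (auto simp: homogeneous_def)
    then show "s \<in> range (associator G \<omega> U V W)"
      by (intro in_range_if_scaled[OF l, of "(u \<otimes>\<^sub>v v) \<otimes>\<^sub>v w" "\<omega> x y z"]) (simp_all add: *[OF h])
  qed simp
qed

lemma braiding:
  assumes V: "center_object G \<omega> V" and W: "center_object G \<omega> W"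
  shows clinear_braiding: "clinear (braiding G V W)"
    and braiding_tensor: "\<lbrakk>x \<in> carrier G; v \<in> component V x\<rbrakk> \<Longrightarrow>
      braiding G V W (v \<otimes>\<^sub>v w) = action W x w \<otimes>\<^sub>v v"
proof -
  note gr = center_grading[OF V] center_grading[OF W] and act = clinear_action[OF W]
  let ?s = "\<lambda>t. \<chi> p. t $ (snd p, fst p)"
  let ?F = "\<lambda>t. \<Sum>x\<in>carrier G. ?s (tensor_map (proj G V x) (action W x) t)"
  let ?Q = "\<lambda>F. \<forall>x\<in>carrier G. \<forall>v\<in>component V x. \<forall>w. F (v \<otimes>\<^sub>v w) = action W x w \<otimes>\<^sub>v v"
  have s: "clinear ?s" by (simp add: clinear_iff vec_eq_iff)
  have lF: "clinear ?F"
    by (auto intro!: clinear_sum clinear_compose[OF s] clinear_tensor_map clinear_proj gr act)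
  have QF: "?Q ?F"
  proof (intro ballI allI)
    fix x v w assume h: "x \<in> carrier G" "v \<in> component V x"
    have "?F (v \<otimes>\<^sub>v w) = ?s (tensor_map (proj G V x) (action W x) (v \<otimes>\<^sub>v w))"
      by (subst sum_eq_single[where a = x])
        (use h in \<open>auto simp: fin tensor_map_tensor act clinear_proj gr
          proj_homogeneous[OF gr(1) _ h] vec_eq_iff\<close>)
    also have "\<dots> = action W x w \<otimes>\<^sub>v v"
      using h by (simp add: tensor_map_tensor act clinear_proj gr
          proj_homogeneous[OF gr(1) _ h] vec_eq_iff mult.commute)
    finally show "?F (v \<otimes>\<^sub>v w) = action W x w \<otimes>\<^sub>v v" .
  qed
  have "braiding G V W = ?F"
    unfolding braiding_def
  proof (rule ex1_clinear_on_spanning[where Q = ?Q, OF lF QF])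
    show "vec.span {v \<otimes>\<^sub>v w | v w. v \<in> homogeneous G V \<and> w \<in> UNIV} = UNIV"
      by (intro span_tensors span_homogeneous gr) simp
    fix F' assume "?Q F'"
    with QF show "\<forall>s\<in>{v \<otimes>\<^sub>v w | v w. v \<in> homogeneous G V \<and> w \<in> UNIV}. F' s = ?F s"
      by (force simp: homogeneous_def)
  qed
  with lF QF show "clinear (braiding G V W)" and "\<lbrakk>x \<in> carrier G; v \<in> component V x\<rbrakk> \<Longrightarrow>
      braiding G V W (v \<otimes>\<^sub>v w) = action W x w \<otimes>\<^sub>v v"
    by simp_all
qed

section \<open>The braid generators on homogeneous tensors\<close>

lemma sigma1:
  assumes U: "center_object G \<omega> U" and V: "center_object G \<omega> V"
  shows clinear_sigma1: "clinear (sigma1 G U V)"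
    and sigma1_tensor: "\<lbrakk>x \<in> carrier G; u \<in> component U x\<rbrakk> \<Longrightarrow>
      sigma1 G U V ((u \<otimes>\<^sub>v v) \<otimes>\<^sub>v w) = (action V x v \<otimes>\<^sub>v u) \<otimes>\<^sub>v w"
  by (simp_all add: sigma1_def clinear_tensor_map tensor_map_tensor clinear_braiding[OF U V]
      clinear_id braiding_tensor[OF U V])

text \<open>
  For surjectivity, \<open>(u \<otimes> w) \<otimes> v\<close> with \<open>v\<close> of degree \<open>y\<close> is, up to a nonzero scalar, the image of
  \<open>(u \<otimes> v) \<otimes> (y\<^sup>-\<^sup>1 \<triangleright> w)\<close>.
\<close>
lemma sigma2:
  assumes U: "center_object G \<omega> U" and V: "center_object G \<omega> V" and W: "center_object G \<omega> W"
  shows clinear_sigma2: "clinear (sigma2 G \<omega> U V W)"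
    and sigma2_tensor: "\<lbrakk>x \<in> carrier G; y \<in> carrier G; z \<in> carrier G;
      u \<in> component U x; v \<in> component V y; w \<in> component W z\<rbrakk> \<Longrightarrow>
      sigma2 G \<omega> U V W ((u \<otimes>\<^sub>v v) \<otimes>\<^sub>v w) =
        (\<omega> x y z * inverse (\<omega> x (y \<triangleright> z) y)) *s ((u \<otimes>\<^sub>v action W y w) \<otimes>\<^sub>v v)"
    and bij_sigma2: "bij (sigma2 G \<omega> U V W)"
proof -
  note la = clinear_associator[OF U V W] and lb = clinear_braiding[OF V W]
    and inv_a = inv_clinear_bij[OF clinear_associator[OF U W V] bij_associator[OF U W V]]
  show l: "clinear (sigma2 G \<omega> U V W)"
    unfolding sigma2_def
    by (intro clinear_comp inv_a(1) la clinear_tensor_map lb clinear_id)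
  show *: "sigma2 G \<omega> U V W ((u \<otimes>\<^sub>v v) \<otimes>\<^sub>v w) =
        (\<omega> x y z * inverse (\<omega> x (y \<triangleright> z) y)) *s ((u \<otimes>\<^sub>v action W y w) \<otimes>\<^sub>v v)"
    if h: "x \<in> carrier G" "y \<in> carrier G" "z \<in> carrier G"
      "u \<in> component U x" "v \<in> component V y" "w \<in> component W z" for x y z u v w
  proof -
    have "inv_into UNIV (associator G \<omega> U W V) (u \<otimes>\<^sub>v (action W y w \<otimes>\<^sub>v v)) =
        inverse (\<omega> x (y \<triangleright> z) y) *s ((u \<otimes>\<^sub>v action W y w) \<otimes>\<^sub>v v)"
      by (rule inv_a(2), rule associator_tensor[OF U W V]) (simp_all add: h action_mem[OF W])
    then show ?thesis
      using h by (simp add: sigma2_def associator_tensor[OF U V W h] clinear_simps(2)[OF inv_a(1)]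
          clinear_simps(2)[OF clinear_tensor_map[OF clinear_id(1) lb]]
          tensor_map_tensor[OF clinear_id(1) lb] braiding_tensor[OF V W h(2,5)])
  qed
  show "bij (sigma2 G \<omega> U V W)"
  proof (rule clinear_bij_if_range_spans[OF l])
    let ?S = "triple_tensors (homogeneous G U) (homogeneous G W) (homogeneous G V)"
    show "vec.span ?S = UNIV"
      by (intro span_triple_tensors span_homogeneous center_grading U V W)
    fix s assume "s \<in> ?S"
    then obtain x y z u v w where h [simp]: "x \<in> carrier G" "y \<in> carrier G" "z \<in> carrier G"
      "u \<in> component U x" "v \<in> component V y" "w \<in> component W z" and s: "s = (u \<otimes>\<^sub>v w) \<otimes>\<^sub>v v"
      by (auto simp: homogeneous_def triple_tensors_def)
    let ?c = "\<omega> x y (inv y \<triangleright> z) * inverse (\<omega> x z y) * alpha G \<omega> z y (inv y)"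
    have "sigma2 G \<omega> U V W ((u \<otimes>\<^sub>v v) \<otimes>\<^sub>v action W (inv y) w) = ?c *s s"
      by (subst *[where x = x and y = y and z = "inv y \<triangleright> z"])
        (simp_all add: action_mem[OF W] action_action[OF W _ _ h(3,6)] action_one[OF W] s)
    then show "s \<in> range (sigma2 G \<omega> U V W)" by (rule in_range_if_scaled[OF l]) simp
  qed simp
qed

text \<open>
  The braid \<open>\<sigma>\<^sub>2\<^sup>-\<^sup>1 \<sigma>\<^sub>1\<close>, which moves the first factor to the last position.
\<close>
definition braid_step ::
    "('a, 'i::finite) graded_rep \<Rightarrow> ('a, 'j::finite) graded_rep \<Rightarrow> ('a, 'l::finite) graded_rep
      \<Rightarrow> complex ^ (('i \<times> 'j) \<times> 'l) \<Rightarrow> complex ^ (('j \<times> 'l) \<times> 'i)"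
  where "braid_step U V W = inv_into UNIV (sigma2 G \<omega> V W U) \<circ> sigma1 G U V"

lemma borromean_braid_eq:
  "borromean_braid G \<omega> U V W = braid_step W U V \<circ> braid_step V W U \<circ> braid_step U V W"
  by (simp add: borromean_braid_def braid_step_def comp_assoc)

lemma clinear_braid_step:
  assumes "center_object G \<omega> U" "center_object G \<omega> V" "center_object G \<omega> W"
  shows "clinear (braid_step U V W)"
  unfolding braid_step_def
  by (intro clinear_comp clinear_inv clinear_sigma2 bij_sigma2 clinear_sigma1 assms)

text \<open>
  Here \<open>\<sigma>\<^sub>2\<^sup>-\<^sup>1\<close> is found by guessing the preimage: the generator \<open>\<sigma>\<^sub>2\<close> sends
  \<open>((x \<triangleright> v) \<otimes> w) \<otimes> (z\<^sup>-\<^sup>1 \<triangleright> u)\<close> to a multiple of \<open>((x \<triangleright> v) \<otimes> u) \<otimes> w\<close>, and the multiple is the inverse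
  of \<open>\<psi>\<close>; its factor \<open>\<alpha>\<close> comes from \<open>z \<triangleright> (z\<^sup>-\<^sup>1 \<triangleright> u)\<close>.
\<close>
lemma braid_step_tensor:
  assumes U: "center_object G \<omega> U" and V: "center_object G \<omega> V" and W: "center_object G \<omega> W"
    and h [simp]: "x \<in> carrier G" "y \<in> carrier G" "z \<in> carrier G"
      "u \<in> component U x" "v \<in> component V y" "w \<in> component W z"
  shows "braid_step U V W ((u \<otimes>\<^sub>v v) \<otimes>\<^sub>v w) =
    psi G \<omega> x (inv z \<triangleright> x) (x \<triangleright> y) z *s ((action V x v \<otimes>\<^sub>v w) \<otimes>\<^sub>v action U (inv z) u)"
proof -
  let ?x = "inv z \<triangleright> x" and ?y = "x \<triangleright> y"
  let ?c = "\<omega> ?y z ?x * inverse (\<omega> ?y x z) * alpha G \<omega> x z (inv z)"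
  have "sigma2 G \<omega> V W U ((action V x v \<otimes>\<^sub>v w) \<otimes>\<^sub>v action U (inv z) u) =
      ?c *s ((action V x v \<otimes>\<^sub>v u) \<otimes>\<^sub>v w)"
    by (subst sigma2_tensor[OF V W U, where x = ?y and y = z and z = ?x])
      (simp_all add: action_mem[OF V] action_mem[OF U] action_action[OF U _ _ h(1,4)] action_one[OF U])
  then have "inv_into UNIV (sigma2 G \<omega> V W U) ((action V x v \<otimes>\<^sub>v u) \<otimes>\<^sub>v w) =
      inverse ?c *s ((action V x v \<otimes>\<^sub>v w) \<otimes>\<^sub>v action U (inv z) u)"
    by (rule inv_clinear_scale[OF clinear_sigma2[OF V W U] bij_sigma2[OF V W U]]) simp
  then show ?thesis
    by (simp add: braid_step_def sigma1_tensor[OF U V h(1,4)] psi_def mult_ac)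
qed

section \<open>The trace of the Borromean braid\<close>

lemma clinear_borromean_braid:
  assumes "center_object G \<omega> U" "center_object G \<omega> V" "center_object G \<omega> W"
  shows "clinear (borromean_braid G \<omega> U V W)"
  unfolding borromean_braid_eq by (intro clinear_comp clinear_braid_step assms)

text \<open>
  No condition on the degrees is imposed: the result lies in the block of degree
  \<open>(z' \<triangleright> x', y'', y''\<^sup>-\<^sup>1 \<triangleright> z')\<close>, which decides whether the block contributes to the trace.
\<close>
lemma borromean_braid_tensor:
  assumes U: "center_object G \<omega> U" and V: "center_object G \<omega> V" and W: "center_object G \<omega> W"
    and h [simp]: "x \<in> carrier G" "y \<in> carrier G" "z \<in> carrier G"
      "u \<in> component U x" "v \<in> component V y" "w \<in> component W z"
    and defs: "x' = inv z \<triangleright> x" "y' = x \<triangleright> y" "z' = y' \<triangleright> z" "y'' = inv x' \<triangleright> y'"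
  shows "borromean_braid G \<omega> U V W ((u \<otimes>\<^sub>v v) \<otimes>\<^sub>v w) =
    (psi G \<omega> x x' y' z * psi G \<omega> y' y'' z' x' * psi G \<omega> z' (inv y'' \<triangleright> z') (z' \<triangleright> x') y'') *s
      ((action U z' (action U (inv z) u) \<otimes>\<^sub>v action V (inv x') (action V x v)) \<otimes>\<^sub>v
        action W (inv y'') (action W y' w))"
proof -
  have [simp]: "x' \<in> carrier G" "y' \<in> carrier G" "z' \<in> carrier G" "y'' \<in> carrier G"
    by (simp_all add: defs)
  have m: "action U (inv z) u \<in> component U x'" "action V x v \<in> component V y'"
      "action W y' w \<in> component W z'" "action V (inv x') (action V x v) \<in> component V y''"
    by (simp_all add: defs action_mem[OF U] action_mem[OF V] action_mem[OF W])
  have "braid_step U V W ((u \<otimes>\<^sub>v v) \<otimes>\<^sub>v w) =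
      psi G \<omega> x x' y' z *s ((action V x v \<otimes>\<^sub>v w) \<otimes>\<^sub>v action U (inv z) u)"
    using braid_step_tensor[OF U V W h] by (simp add: defs)
  moreover have "braid_step V W U ((action V x v \<otimes>\<^sub>v w) \<otimes>\<^sub>v action U (inv z) u) =
      psi G \<omega> y' y'' z' x' *s
        ((action W y' w \<otimes>\<^sub>v action U (inv z) u) \<otimes>\<^sub>v action V (inv x') (action V x v))"
    using braid_step_tensor[OF V W U _ _ _ m(2) h(6) m(1)] by (simp add: defs(3,4))
  moreover have "braid_step W U V
        ((action W y' w \<otimes>\<^sub>v action U (inv z) u) \<otimes>\<^sub>v action V (inv x') (action V x v)) =
      psi G \<omega> z' (inv y'' \<triangleright> z') (z' \<triangleright> x') y'' *s
        ((action U z' (action U (inv z) u) \<otimes>\<^sub>v action V (inv x') (action V x v)) \<otimes>\<^sub>v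
        action W (inv y'') (action W y' w))"
    using braid_step_tensor[OF W U V _ _ _ m(3) m(1) m(4)] by simp
  ultimately show ?thesis
    by (simp add: borromean_braid_eq clinear_simps(2)[OF clinear_braid_step[OF V W U]]
        clinear_simps(2)[OF clinear_braid_step[OF W U V]] mult_ac)
qed

lemma borromean_braid_block:
  assumes U: "center_object G \<omega> U" and V: "center_object G \<omega> V" and W: "center_object G \<omega> W"
    and h [simp]: "x \<in> carrier G" "y \<in> carrier G" "z \<in> carrier G"
      "u \<in> component U x" "v \<in> component V y" "w \<in> component W z"
    and c: "borromean_cond G x y z"
  shows "borromean_braid G \<omega> U V W ((u \<otimes>\<^sub>v v) \<otimes>\<^sub>v w) =
    Omega G \<omega> x y z *s
      ((action U \<lbrakk>y, z\<rbrakk> u \<otimes>\<^sub>v action V \<lbrakk>inv z, inv x\<rbrakk> v) \<otimes>\<^sub>v action W \<lbrakk>inv y, x\<rbrakk> w)"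
proof -
  note d = borromean_cond_conjugates[OF c h(1-3)]
  have g: "(y \<triangleright> z) \<otimes> inv z = \<lbrakk>y, z\<rbrakk>" "inv (inv z \<triangleright> x) \<otimes> x = \<lbrakk>inv z, inv x\<rbrakk>"
    "inv y \<otimes> (x \<triangleright> y) = \<lbrakk>inv y, x\<rbrakk>"
    by (simp_all add: group_normal)
  show ?thesis
    using borromean_braid_tensor[OF U V W h refl refl refl refl]
    by (simp add: d action_action[OF U _ _ h(1,4)] action_action[OF V _ _ h(2,5)]
        action_action[OF W _ _ h(3,6)] g Omega_def conjugate_inv mult_ac)
qed

text \<open>
  The projection of the triple tensor product to its block of degree \<open>(x, y, z)\<close>.
\<close>
definition block ::
    "('a, 'i::finite) graded_rep \<Rightarrow> ('a, 'j::finite) graded_rep \<Rightarrow> ('a, 'l::finite) graded_rep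
      \<Rightarrow> 'a \<Rightarrow> 'a \<Rightarrow> 'a \<Rightarrow> complex ^ (('i \<times> 'j) \<times> 'l) \<Rightarrow> complex ^ (('i \<times> 'j) \<times> 'l)"
  where "block U V W x y z = tensor_map (tensor_map (proj G U x) (proj G V y)) (proj G W z)"

lemma block:
  assumes U: "grading G (component U)" and V: "grading G (component V)" and W: "grading G (component W)"
    and h: "x \<in> carrier G" "y \<in> carrier G" "z \<in> carrier G"
  shows clinear_block: "clinear (block U V W x y z)"
    and block_tensor: "block U V W x y z ((u \<otimes>\<^sub>v v) \<otimes>\<^sub>v w) =
      (proj G U x u \<otimes>\<^sub>v proj G V y v) \<otimes>\<^sub>v proj G W z w"
  by (simp_all add: block_def clinear_tensor_map tensor_map_tensor clinear_proj assms)

lemma sum_block: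
  assumes U: "grading G (component U)" and V: "grading G (component V)" and W: "grading G (component W)"
  shows "(\<Sum>(x, y, z)\<in>carrier G \<times> carrier G \<times> carrier G. block U V W x y z t) = t"
proof -
  have "(\<lambda>t. \<Sum>(x, y, z)\<in>carrier G \<times> carrier G \<times> carrier G. block U V W x y z t) = (\<lambda>t. t)"
  proof (rule clinear_eq_on_spanning)
    show "clinear (\<lambda>t. \<Sum>(x, y, z)\<in>carrier G \<times> carrier G \<times> carrier G. block U V W x y z t)"
      by (auto intro!: clinear_sum clinear_block U V W simp: case_prod_unfold)
    let ?S = "triple_tensors (homogeneous G U) (homogeneous G V) (homogeneous G W)"
    show "vec.span ?S = UNIV"
      by (intro span_triple_tensors span_homogeneous U V W)
    fix s assume "s \<in> ?S"
    then obtain x y z u v w where h: "x \<in> carrier G" "y \<in> carrier G" "z \<in> carrier G"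
      "u \<in> component U x" "v \<in> component V y" "w \<in> component W z" and s: "s = (u \<otimes>\<^sub>v v) \<otimes>\<^sub>v w"
      by (auto simp: homogeneous_def triple_tensors_def)
    show "(\<Sum>(x, y, z)\<in>carrier G \<times> carrier G \<times> carrier G. block U V W x y z s) = s"
      by (subst sum_eq_single[where a = "(x, y, z)"])
        (use h in \<open>auto simp: s fin block_tensor U V W proj_homogeneous[OF U _ h(1,4)]
          proj_homogeneous[OF V _ h(2,5)] proj_homogeneous[OF W _ h(3,6)] split: if_splits\<close>)
  qed (rule clinear_id)
  then show ?thesis by meson
qed

text \<open>
  On a block that is mapped to itself the braid is \<open>\<Omega>\<close> times a tensor product of three maps, whose
  trace is multiplicative. Any other block is mapped to a block of different degree; as the block
  projection \<open>P\<close> is idempotent, the trace of \<open>M P\<close> is that of \<open>P M P = 0\<close>.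
\<close>
lemma ltrace_block:
  assumes U: "center_object G \<omega> U" and V: "center_object G \<omega> V" and W: "center_object G \<omega> W"
    and h [simp]: "x \<in> carrier G" "y \<in> carrier G" "z \<in> carrier G"
  shows "ltrace (\<lambda>t. borromean_braid G \<omega> U V W (block U V W x y z t)) =
    (if borromean_cond G x y z then Omega G \<omega> x y z * component_trace G U x \<lbrakk>y, z\<rbrakk> *
      component_trace G V y \<lbrakk>inv z, inv x\<rbrakk> * component_trace G W z \<lbrakk>inv y, x\<rbrakk> else 0)"
proof -
  note gr = center_grading[OF U] center_grading[OF V] center_grading[OF W]
  let ?M = "borromean_braid G \<omega> U V W" and ?P = "block U V W x y z"
  have lM: "clinear ?M" and lP: "clinear ?P"
    by (simp_all add: clinear_borromean_braid U V W clinear_block gr)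
  have lMP: "clinear (\<lambda>t. ?M (?P t))"
    by (rule clinear_compose[OF lM lP])
  have p: "proj G U x u \<in> component U x" "proj G V y v \<in> component V y" "proj G W z w \<in> component W z"
    for u v w by (simp_all add: proj_mem gr)
  show ?thesis
  proof (cases "borromean_cond G x y z")
    case True
    let ?f = "\<lambda>u. action U \<lbrakk>y, z\<rbrakk> (proj G U x u)"
    let ?g = "\<lambda>v. action V \<lbrakk>inv z, inv x\<rbrakk> (proj G V y v)"
    let ?h = "\<lambda>w. action W \<lbrakk>inv y, x\<rbrakk> (proj G W z w)"
    have l: "clinear ?f" "clinear ?g" "clinear ?h"
      by (simp_all add: clinear_compose[OF clinear_action clinear_proj] U V W gr)
    note l' = clinear_tensor_map[OF l(1,2)]
    have "(\<lambda>t. ?M (?P t)) = (\<lambda>t. Omega G \<omega> x y z *s tensor_map (tensor_map ?f ?g) ?h t)"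
      by (rule clinear_eq_on_triple_tensors[OF lMP clinear_scale[OF clinear_tensor_map[OF l' l(3)]]])
        (simp add: block_tensor gr borromean_braid_block[OF U V W h p True] tensor_map_tensor[OF l(1,2)]
          tensor_map_tensor[OF l' l(3)])
    then have "ltrace (\<lambda>t. ?M (?P t)) = Omega G \<omega> x y z * (ltrace ?f * ltrace ?g * ltrace ?h)"
      by (simp only: ltrace_scale ltrace_tensor_map[OF l' l(3)] ltrace_tensor_map[OF l(1,2)])
    with True show ?thesis by (simp add: component_trace_def)
  next
    case False
    define x' y' where "x' = inv z \<triangleright> x" and "y' = x \<triangleright> y"
    define z' y'' where "z' = y' \<triangleright> z" and "y'' = inv x' \<triangleright> y'"
    note defs = x'_def y'_def z'_def y''_def
    have [simp]: "x' \<in> carrier G" "y' \<in> carrier G" "z' \<in> carrier G" "y'' \<in> carrier G"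
      by (simp_all add: defs)
    have ne: "z' \<triangleright> x' \<noteq> x \<or> y'' \<noteq> y \<or> inv y'' \<triangleright> z' \<noteq> z"
      using False borromean_cond_if_fixed[OF h] by (auto simp: defs)
    have PP: "(\<lambda>t. ?P (?P t)) = ?P"
      by (rule clinear_eq_on_triple_tensors[OF clinear_compose[OF lP lP] lP])
        (simp add: block_tensor gr proj_id[OF gr(1)] proj_id[OF gr(2)] proj_id[OF gr(3)] p)
    have "(\<lambda>t. ?P (?M (?P t))) = (\<lambda>t. 0)"
    proof (rule clinear_eq_on_triple_tensors)
      show "clinear (\<lambda>t. ?P (?M (?P t)))" by (rule clinear_compose[OF lP lMP])
      show "clinear (\<lambda>t. 0)" by (simp add: clinear_iff)
      fix u v w
      let ?a = "action U z' (action U (inv z) (proj G U x u))"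
      let ?b = "action V (inv x') (action V x (proj G V y v))"
      let ?c = "action W (inv y'') (action W y' (proj G W z w))"
      have a: "?a \<in> component U (z' \<triangleright> x')"
        by (simp add: action_mem[OF U] p x'_def)
      have b: "?b \<in> component V y''"
        by (simp add: action_mem[OF V] p y''_def y'_def)
      have c: "?c \<in> component W (inv y'' \<triangleright> z')"
        by (simp add: action_mem[OF W] p z'_def)
      have "(proj G U x ?a \<otimes>\<^sub>v proj G V y ?b) \<otimes>\<^sub>v proj G W z ?c = 0"
        using ne by (auto simp: proj_homogeneous[OF gr(1) _ _ a] proj_homogeneous[OF gr(2) _ _ b]
            proj_homogeneous[OF gr(3) _ _ c])
      then show "?P (?M (?P ((u \<otimes>\<^sub>v v) \<otimes>\<^sub>v w))) = 0"
        by (simp add: block_tensor gr clinear_simps(2)[OF lP]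
            borromean_braid_tensor[OF U V W h p x'_def y'_def z'_def y''_def])
    qed
    then have "ltrace (\<lambda>t. ?P (?M (?P t))) = 0" by (simp only: ltrace_zero)
    moreover have "ltrace (\<lambda>t. ?M (?P (?P t))) = ltrace (\<lambda>t. ?P (?M (?P t)))"
      by (rule ltrace_commute[OF lMP lP])
    moreover have "?P (?P t) = ?P t" for t by (rule fun_cong[OF PP])
    ultimately show ?thesis using False by simp
  qed
qed

lemma borromean_tensor_blocks:
  assumes U: "center_object G \<omega> U" and V: "center_object G \<omega> V" and W: "center_object G \<omega> W"
  shows "borromean_tensor G \<omega> U V W =
    (\<Sum>(x, y, z)\<in>{(x, y, z)\<in>carrier G \<times> carrier G \<times> carrier G. borromean_cond G x y z}.
      Omega G \<omega> x y z * component_trace G U x \<lbrakk>y, z\<rbrakk> *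
      component_trace G V y \<lbrakk>inv z, inv x\<rbrakk> * component_trace G W z \<lbrakk>inv y, x\<rbrakk>)"
proof -
  let ?M = "borromean_braid G \<omega> U V W" and ?C = "carrier G \<times> carrier G \<times> carrier G"
  note gr = center_grading[OF U] center_grading[OF V] center_grading[OF W]
  have "?M t = (\<Sum>q\<in>?C. ?M (block U V W (fst q) (fst (snd q)) (snd (snd q)) t))" for t
    by (subst sum_block[OF gr, of t, symmetric])
      (simp add: clinear_simps(4)[OF clinear_borromean_braid[OF U V W]] case_prod_unfold)
  then have "?M = (\<lambda>t. \<Sum>q\<in>?C. ?M (block U V W (fst q) (fst (snd q)) (snd (snd q)) t))"
    by (rule ext)
  then have "borromean_tensor G \<omega> U V W =
      ltrace (\<lambda>t. \<Sum>q\<in>?C. ?M (block U V W (fst q) (fst (snd q)) (snd (snd q)) t))"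
    unfolding borromean_tensor_def by (rule arg_cong)
  also have "\<dots> = (\<Sum>q\<in>?C. ltrace (\<lambda>t. ?M (block U V W (fst q) (fst (snd q)) (snd (snd q)) t)))"
    by (rule ltrace_sum)
  also have "\<dots> = (\<Sum>(x, y, z)\<in>?C. if borromean_cond G x y z then Omega G \<omega> x y z *
      component_trace G U x \<lbrakk>y, z\<rbrakk> * component_trace G V y \<lbrakk>inv z, inv x\<rbrakk> *
      component_trace G W z \<lbrakk>inv y, x\<rbrakk> else 0)"
    by (rule sum.cong) (auto simp: ltrace_block[OF U V W])
  also have "\<dots> = (\<Sum>(x, y, z)\<in>{(x, y, z)\<in>?C. borromean_cond G x y z}.
      Omega G \<omega> x y z * component_trace G U x \<lbrakk>y, z\<rbrakk> *
      component_trace G V y \<lbrakk>inv z, inv x\<rbrakk> * component_trace G W z \<lbrakk>inv y, x\<rbrakk>)"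
    by (rule sum.mono_neutral_cong_right) (auto simp: fin split: if_splits)
  finally show ?thesis .
qed

section \<open>The Borromean tensor as a sum over degrees\<close>

lemma correspondsD:
  assumes "corresponds G \<omega> V g \<xi>"
  shows "center_object G \<omega> V" "g \<in> carrier G"
    "c \<in> carrier G \<Longrightarrow> c \<triangleright> g = g \<Longrightarrow> \<xi> c = component_trace G V g c"
    "x \<in> carrier G \<Longrightarrow> x \<notin> conj_class G g \<Longrightarrow> component V x = {0}"
  using assms by (auto simp: corresponds_def simple_object_def centralizer_iff)

lemma component_trace_outside_support:
  assumes "center_object G \<omega> V" "x \<in> carrier G" "c \<in> carrier G" "component V x = {0}"
  shows "component_trace G V x c = 0"
proof -
  have "proj G V x w = 0" for w
    using proj_mem[OF center_grading[OF assms(1)] assms(2), of w] assms(4) by simp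
  then show ?thesis
    by (simp add: component_trace_def clinear_simps(3)[OF clinear_action[OF assms(1,3)]] ltrace_zero)
qed

text \<open>
  The transported character is defined by a formula; this identifies it with the character of the
  centralizer of \<open>f \<triangleright> g\<close> on the component of that degree. In particular it depends on \<open>f\<close> only through
  \<open>f \<triangleright> g\<close>.
\<close>
lemma transport_char_eq:
  assumes V: "corresponds G \<omega> V g \<xi>" and [simp]: "f \<in> carrier G" "c \<in> carrier G"
    and c: "c \<triangleright> (f \<triangleright> g) = f \<triangleright> g"
  shows "transport_char G \<omega> g \<xi> f c = component_trace G V (f \<triangleright> g) c"
proof -
  have [simp]: "g \<in> carrier G" using correspondsD(2)[OF V] .
  have "(inv f \<triangleright> c) \<triangleright> (inv f \<triangleright> (f \<triangleright> g)) = inv f \<triangleright> (c \<triangleright> (f \<triangleright> g))"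
    by (subst conjugate_distrib[symmetric]) simp_all
  then have d: "(inv f \<triangleright> c) \<triangleright> g = g" by (simp add: c)
  show ?thesis
    using component_trace_conjugate[OF correspondsD(1)[OF V] _ _ _ d, of f] correspondsD(3)[OF V _ d]
    by (simp add: transport_char_def conj_ratio_def divide_inverse)
qed

lemma char_at_eq:
  assumes V: "corresponds G \<omega> V g \<xi>" and x: "x \<in> conj_class G g" and c: "c \<in> carrier G" "c \<triangleright> x = x"
  shows "char_at G \<omega> g \<xi> x c = component_trace G V x c"
proof -
  define f where "f = (SOME f. f \<in> carrier G \<and> f \<triangleright> g = x)"
  have "\<exists>f. f \<in> carrier G \<and> f \<triangleright> g = x"
    using x by (auto simp: conj_class_def)
  then have f: "f \<in> carrier G" "f \<triangleright> g = x"
    unfolding f_def by (metis (mono_tags, lifting) someI_ex)+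
  have "char_at G \<omega> g \<xi> x c = transport_char G \<omega> g \<xi> f c"
    by (simp add: char_at_def f_def)
  then show ?thesis
    using transport_char_eq[OF V f(1) c(1)] c(2) f(2) by simp
qed

text \<open>
  The trace of the braid on the block of degree \<open>(x, y, z)\<close>, expressed by the traces on the components
  themselves, without choosing conjugators.
\<close>
definition summand ::
    "('a, 'i::finite) graded_rep \<Rightarrow> ('a, 'j::finite) graded_rep \<Rightarrow> ('a, 'l::finite) graded_rep
      \<Rightarrow> 'a \<Rightarrow> 'a \<Rightarrow> 'a \<Rightarrow> complex"
  where "summand U V W x y z = Omega G \<omega> x y z * component_trace G U x \<lbrakk>y, z\<rbrakk> *
    component_trace G V y \<lbrakk>inv z, inv x\<rbrakk> * component_trace G W z \<lbrakk>inv y, x\<rbrakk>"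

text \<open>
  The scalars by which the three characters change are exactly those by which \<open>\<Omega>\<close> changes.
\<close>
lemma summand_conjugate:
  assumes U: "center_object G \<omega> U" and V: "center_object G \<omega> V" and W: "center_object G \<omega> W"
    and c: "borromean_cond G x y z"
    and [simp]: "f \<in> carrier G" "x \<in> carrier G" "y \<in> carrier G" "z \<in> carrier G"
  shows "summand U V W (f \<triangleright> x) (f \<triangleright> y) (f \<triangleright> z) = summand U V W x y z"
proof -
  note d = borromean_condD[OF c]
  have e: "\<lbrakk>f \<triangleright> y, f \<triangleright> z\<rbrakk> = f \<triangleright> \<lbrakk>y, z\<rbrakk>" "\<lbrakk>inv (f \<triangleright> z), inv (f \<triangleright> x)\<rbrakk> = f \<triangleright> \<lbrakk>inv z, inv x\<rbrakk>"
    "\<lbrakk>inv (f \<triangleright> y), f \<triangleright> x\<rbrakk> = f \<triangleright> \<lbrakk>inv y, x\<rbrakk>"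
    by (simp_all add: conjugate_commutator conjugate_inv)
  show ?thesis
    unfolding summand_def e
    using component_trace_conjugate[OF U _ _ _ d(4), of f] component_trace_conjugate[OF V _ _ _ d(3), of f]
      component_trace_conjugate[OF W _ _ _ d(1), of f] Omega_conjugate[OF c, of f, symmetric]
    by simp
qed

lemma borromean_tensor_sum:
  assumes U: "corresponds G \<omega> U g \<chi>1" and V: "corresponds G \<omega> V h \<chi>2" and W: "corresponds G \<omega> W k \<chi>3"
  shows "borromean_tensor G \<omega> U V W =
    (\<Sum>(x, y, z)\<in>{(x, y, z). x \<in> conj_class G g \<and> y \<in> conj_class G h \<and> z \<in> conj_class G k \<and>
      borromean_cond G x y z}. summand U V W x y z)"
proof -
  note o = correspondsD(1)[OF U] correspondsD(1)[OF V] correspondsD(1)[OF W]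
  note cl = conj_class_carrier[OF correspondsD(2)[OF U]] conj_class_carrier[OF correspondsD(2)[OF V]]
    conj_class_carrier[OF correspondsD(2)[OF W]]
  have z: "summand U V W x y z = 0"
    if "x \<in> carrier G" "y \<in> carrier G" "z \<in> carrier G"
      "\<not> (x \<in> conj_class G g \<and> y \<in> conj_class G h \<and> z \<in> conj_class G k)" for x y z
  proof -
    have "component U x = {0} \<or> component V y = {0} \<or> component W z = {0}"
      using that correspondsD(4)[OF U] correspondsD(4)[OF V] correspondsD(4)[OF W] by blast
    then have "component_trace G U x \<lbrakk>y, z\<rbrakk> = 0 \<or> component_trace G V y \<lbrakk>inv z, inv x\<rbrakk> = 0 \<or>
        component_trace G W z \<lbrakk>inv y, x\<rbrakk> = 0"
      using component_trace_outside_support[OF o(1) that(1)] component_trace_outside_support[OF o(2) that(2)]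
        component_trace_outside_support[OF o(3) that(3)] that(1-3) by auto
    then show ?thesis by (auto simp: summand_def)
  qed
  have "borromean_tensor G \<omega> U V W =
    (\<Sum>(x, y, z)\<in>{(x, y, z)\<in>carrier G \<times> carrier G \<times> carrier G. borromean_cond G x y z}.
      summand U V W x y z)"
    unfolding summand_def by (rule borromean_tensor_blocks[OF o])
  also have "\<dots> = (\<Sum>(x, y, z)\<in>{(x, y, z). x \<in> conj_class G g \<and> y \<in> conj_class G h \<and>
      z \<in> conj_class G k \<and> borromean_cond G x y z}. summand U V W x y z)"
  proof (rule sum.mono_neutral_right)
    show "finite {(x, y, z)\<in>carrier G \<times> carrier G \<times> carrier G. borromean_cond G x y z}"
      by (rule finite_subset[of _ "carrier G \<times> carrier G \<times> carrier G"]) (auto simp: fin)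
      let ?D = "{(x, y, z)\<in>carrier G \<times> carrier G \<times> carrier G. borromean_cond G x y z} -
        {(x, y, z). x \<in> conj_class G g \<and> y \<in> conj_class G h \<and> z \<in> conj_class G k \<and>
          borromean_cond G x y z}"
    show "\<forall>q\<in>?D. (case q of (x, y, z) \<Rightarrow> summand U V W x y z) = 0"
    proof
      fix q assume "q \<in> ?D"
      then obtain x y z where "q = (x, y, z)" "x \<in> carrier G" "y \<in> carrier G" "z \<in> carrier G"
        "\<not> (x \<in> conj_class G g \<and> y \<in> conj_class G h \<and> z \<in> conj_class G k)"
        by auto
      then show "(case q of (x, y, z) \<Rightarrow> summand U V W x y z) = 0" by (simp add: z)
    qed
  qed (use cl in auto)
  finally show ?thesis .
qed

text \<open>
  By \<open>summand_conjugate\<close> the inner sum over \<open>(x, y)\<close> is the same for all \<open>z\<close> in the class of \<open>k\<close>.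
\<close>
lemma borromean_tensor_two_sums:
  assumes U: "corresponds G \<omega> U g \<chi>1" and V: "corresponds G \<omega> V h \<chi>2" and W: "corresponds G \<omega> W k \<chi>3"
  shows "borromean_tensor G \<omega> U V W = of_nat (card (conj_class G k)) *
    (\<Sum>(x, y)\<in>{(x, y). x \<in> conj_class G g \<and> y \<in> conj_class G h \<and>
      \<lbrakk>\<lbrakk>k, y\<rbrakk>, x\<rbrakk> = \<one> \<and> \<lbrakk>\<lbrakk>inv y, x\<rbrakk>, k\<rbrakk> = \<one>}. summand U V W x y k)"
proof -
  note o = correspondsD(1)[OF U] correspondsD(1)[OF V] correspondsD(1)[OF W]
  note gc [simp] = correspondsD(2)[OF U] correspondsD(2)[OF V] correspondsD(2)[OF W]
  note cl = conj_class_carrier[OF gc(1)] conj_class_carrier[OF gc(2)] conj_class_carrier[OF gc(3)]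
  define S where "S = (\<lambda>z. {(x, y). x \<in> conj_class G g \<and> y \<in> conj_class G h \<and> borromean_cond G x y z})"
  let ?s = "\<lambda>z (x, y). summand U V W x y z"
  have fcl: "finite (conj_class G a)" if "a \<in> carrier G" for a
    using finite_subset[OF conj_class_carrier[OF that] fin] .
  have fS: "finite (S z)" for z
    by (rule finite_subset[of _ "conj_class G g \<times> conj_class G h"]) (auto simp: fcl S_def)
  have const: "sum (?s z) (S z) = sum (?s k) (S k)" if z: "z \<in> conj_class G k" for z
  proof -
    obtain f where f [simp]: "f \<in> carrier G" and zf: "z = f \<triangleright> k"
      using z by (auto simp: conj_class_def)
    have 1: "(f \<triangleright> x, f \<triangleright> y) \<in> S z" "summand U V W (f \<triangleright> x) (f \<triangleright> y) z = summand U V W x y k"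
      "inv f \<triangleright> (f \<triangleright> x) = x" "inv f \<triangleright> (f \<triangleright> y) = y"
      if "(x, y) \<in> S k" for x y
    proof -
      from that have xy: "x \<in> conj_class G g" "y \<in> conj_class G h" "borromean_cond G x y k"
        by (simp_all add: S_def)
      then have [simp]: "x \<in> carrier G" "y \<in> carrier G" using cl by auto
      show "(f \<triangleright> x, f \<triangleright> y) \<in> S z"
        using xy by (simp add: S_def zf conj_class_conjugate borromean_cond_conjugate)
      show "summand U V W (f \<triangleright> x) (f \<triangleright> y) z = summand U V W x y k"
        unfolding zf by (rule summand_conjugate[OF o xy(3)]) simp_all
      show "inv f \<triangleright> (f \<triangleright> x) = x" "inv f \<triangleright> (f \<triangleright> y) = y" by simp_all
    qed
    have 2: "(inv f \<triangleright> x, inv f \<triangleright> y) \<in> S k" "f \<triangleright> (inv f \<triangleright> x) = x" "f \<triangleright> (inv f \<triangleright> y) = y"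
      if "(x, y) \<in> S z" for x y
    proof -
      from that have xy: "x \<in> conj_class G g" "y \<in> conj_class G h" "borromean_cond G x y z"
        by (simp_all add: S_def)
      then have [simp]: "x \<in> carrier G" "y \<in> carrier G" using cl by auto
      have "borromean_cond G (inv f \<triangleright> x) (inv f \<triangleright> y) (inv f \<triangleright> z)"
        by (rule borromean_cond_conjugate[OF xy(3)]) (simp_all add: zf)
      then show "(inv f \<triangleright> x, inv f \<triangleright> y) \<in> S k"
        using xy by (simp add: S_def zf conj_class_conjugate)
      show "f \<triangleright> (inv f \<triangleright> x) = x" "f \<triangleright> (inv f \<triangleright> y) = y" by simp_all
    qed
    have 3: "summand U V W (inv f \<triangleright> x) (inv f \<triangleright> y) k = summand U V W x y z" if "(x, y) \<in> S z" for x y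
      using 1(2)[OF 2(1)[OF that]] by (simp only: 2(2,3)[OF that])
    show ?thesis
      by (rule sum.reindex_bij_witness[where i = "\<lambda>(x, y). (f \<triangleright> x, f \<triangleright> y)"
            and j = "\<lambda>(x, y). (inv f \<triangleright> x, inv f \<triangleright> y)"])
        (simp_all only: split_paired_all prod.case 1 2 3)
  qed
  have "borromean_tensor G \<omega> U V W = (\<Sum>(z, p)\<in>Sigma (conj_class G k) S. ?s z p)"
    unfolding borromean_tensor_sum[OF U V W]
    by (rule sum.reindex_bij_witness[where i = "\<lambda>(z, x, y). (x, y, z)" and j = "\<lambda>(x, y, z). (z, x, y)"]) (auto simp: S_def)
  also have "\<dots> = (\<Sum>z\<in>conj_class G k. sum (?s z) (S z))"
    by (rule sum.Sigma[symmetric]) (simp_all add: fcl fS)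
  also have "\<dots> = of_nat (card (conj_class G k)) * sum (?s k) (S k)"
    using const by simp
  also have "S k = {(x, y). x \<in> conj_class G g \<and> y \<in> conj_class G h \<and>
      \<lbrakk>\<lbrakk>k, y\<rbrakk>, x\<rbrakk> = \<one> \<and> \<lbrakk>\<lbrakk>inv y, x\<rbrakk>, k\<rbrakk> = \<one>}"
    using cl by (auto simp: S_def borromean_cond_iff subset_iff)
  finally show ?thesis .
qed

lemma psi_alternative:
  assumes "x \<in> carrier G" "z \<in> carrier G" and "x' = inv z \<triangleright> x"
  shows "psi G \<omega> x x' y z = inverse (\<omega> y z x') * \<omega> y x z * inverse (alpha G \<omega> x' (inv z) z)"
  using assms by (simp add: psi_def alpha_inverse)

text \<open>
  The condition is needed for the middle factor: it turns \<open>x \<triangleright> y\<close>, conjugated by the inverse of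
  \<open>z\<^sup>-\<^sup>1 \<triangleright> x\<close>, into \<open>y\<close>.
\<close>
lemma Omega_alternative:
  assumes [simp]: "x \<in> carrier G" "y \<in> carrier G" "z \<in> carrier G" and c: "borromean_cond G x y z"
  shows "Omega G \<omega> x y z =
    inverse (\<omega> (x \<triangleright> y) z (inv z \<triangleright> x)) * \<omega> (x \<triangleright> y) x z *
    inverse (alpha G \<omega> x z (inv z)) *
    (inverse (\<omega> (y \<triangleright> z) (inv z \<triangleright> x) y) * \<omega> (y \<triangleright> z) (x \<triangleright> y) (inv z \<triangleright> x) *
    inverse (alpha G \<omega> y (inv z \<triangleright> inv x) (inv z \<triangleright> x))) *
    (inverse (\<omega> x y z) * \<omega> x (y \<triangleright> z) y *
    inverse (alpha G \<omega> z (inv y) y)) *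
    (alpha G \<omega> x (y \<triangleright> z) (inv z) *
    alpha G \<omega> y (inv z \<triangleright> inv x) x *
    alpha G \<omega> z (inv y) (x \<triangleright> y))"
proof -
  note d = borromean_cond_conjugates[OF c]
  have "psi G \<omega> (x \<triangleright> y) y (y \<triangleright> z) (inv z \<triangleright> x) = inverse (\<omega> (y \<triangleright> z) (inv z \<triangleright> x) y) *
      \<omega> (y \<triangleright> z) (x \<triangleright> y) (inv z \<triangleright> x) * inverse (alpha G \<omega> y (inv z \<triangleright> inv x) (inv z \<triangleright> x))"
    by (subst psi_alternative) (simp_all add: d conjugate_inv)
  moreover have "psi G \<omega> (y \<triangleright> z) z x y = inverse (\<omega> x y z) * \<omega> x (y \<triangleright> z) y *
      inverse (alpha G \<omega> z (inv y) y)"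
    by (subst psi_alternative) simp_all
  ultimately show ?thesis
    unfolding Omega_def by (simp only: psi_def)
qed

end

theorem mainTheorem2:
  fixes G :: "('a, 'b) monoid_scheme" (structure)
    and \<omega> :: "'a \<Rightarrow> 'a \<Rightarrow> 'a \<Rightarrow> complex"
    and U :: "('a, 'i::finite) graded_rep"
    and V :: "('a, 'j::finite) graded_rep"
    and W :: "('a, 'l::finite) graded_rep"
    and g h k :: 'a
    and \<chi>1 \<chi>2 \<chi>3 :: "'a \<Rightarrow> complex"
  assumes "group G" and "finite (carrier G)"
    and "normalized_3cocycle G \<omega>"
    and "corresponds G \<omega> U g \<chi>1"
    and "corresponds G \<omega> V h \<chi>2"
    and "corresponds G \<omega> W k \<chi>3"
  shows
    "(\<forall>x\<in>carrier G. \<forall>x'\<in>carrier G. \<forall>y\<in>carrier G. \<forall>z\<in>carrier G. x' = inv z \<triangleright> x \<longrightarrow>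
        psi G \<omega> x x' y z =
          inverse (\<omega> y z x') * \<omega> y x z * inverse (alpha G \<omega> x' (inv z) z)) \<and>
     (\<forall>x\<in>carrier G. \<forall>y\<in>carrier G. \<forall>z\<in>carrier G. borromean_cond G x y z \<longrightarrow>
        Omega G \<omega> x y z =
          inverse (\<omega> (x \<triangleright> y) z (inv z \<triangleright> x)) * \<omega> (x \<triangleright> y) x z *
          inverse (alpha G \<omega> x z (inv z)) *
          (inverse (\<omega> (y \<triangleright> z) (inv z \<triangleright> x) y) * \<omega> (y \<triangleright> z) (x \<triangleright> y) (inv z \<triangleright> x) *
          inverse (alpha G \<omega> y (inv z \<triangleright> inv x) (inv z \<triangleright> x))) *
          (inverse (\<omega> x y z) * \<omega> x (y \<triangleright> z) y *
          inverse (alpha G \<omega> z (inv y) y)) *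
          (alpha G \<omega> x (y \<triangleright> z) (inv z) *
          alpha G \<omega> y (inv z \<triangleright> inv x) x *
          alpha G \<omega> z (inv y) (x \<triangleright> y))) \<and>
     (borromean_tensor G \<omega> U V W =
        (\<Sum>(x, y, z) \<in> {(x, y, z). x \<in> conj_class G g \<and> y \<in> conj_class G h \<and> z \<in> conj_class G k \<and>
                             borromean_cond G x y z}.
           Omega G \<omega> x y z *
           char_at G \<omega> g \<chi>1 x \<lbrakk>y, z\<rbrakk> *
           char_at G \<omega> h \<chi>2 y \<lbrakk>inv z, inv x\<rbrakk> *
           char_at G \<omega> k \<chi>3 z \<lbrakk>inv y, x\<rbrakk>)) \<and>
     (borromean_tensor G \<omega> U V W =
        of_nat (card (conj_class G k)) *
        (\<Sum>(x, y) \<in> {(x, y). x \<in> conj_class G g \<and> y \<in> conj_class G h \<and>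
                          \<lbrakk>\<lbrakk>k, y\<rbrakk>, x\<rbrakk> = \<one> \<and> \<lbrakk>\<lbrakk>inv y, x\<rbrakk>, k\<rbrakk> = \<one>}.
           Omega G \<omega> x y k *
           char_at G \<omega> g \<chi>1 x \<lbrakk>y, k\<rbrakk> *
           char_at G \<omega> h \<chi>2 y \<lbrakk>inv k, inv x\<rbrakk> *
           \<chi>3 \<lbrakk>inv y, x\<rbrakk>)) \<and>
     (\<forall>P Q. left_transversal G (centralizer G g) P \<longrightarrow> left_transversal G (centralizer G h) Q \<longrightarrow>
        borromean_tensor G \<omega> U V W =
        of_nat (card (conj_class G k)) *
        (\<Sum>(p, q) \<in> {(p, q). p \<in> P \<and> q \<in> Q \<and>
                          \<lbrakk>\<lbrakk>k, q \<triangleright> h\<rbrakk>, p \<triangleright> g\<rbrakk> = \<one> \<and> \<lbrakk>\<lbrakk>inv (q \<triangleright> h), p \<triangleright> g\<rbrakk>, k\<rbrakk> = \<one>}.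
           Omega G \<omega> (p \<triangleright> g) (q \<triangleright> h) k *
           transport_char G \<omega> g \<chi>1 p \<lbrakk>q \<triangleright> h, k\<rbrakk> *
           transport_char G \<omega> h \<chi>2 q \<lbrakk>inv k, p \<triangleright> inv g\<rbrakk> *
           \<chi>3 \<lbrakk>inv (q \<triangleright> h), p \<triangleright> g\<rbrakk>)) \<and>
     (borromean_tensor G \<omega> U V W =
        of_nat (card (conj_class G g)) * of_nat (card (conj_class G h)) *
          of_nat (card (conj_class G k)) / (of_nat (order G))\<^sup>2 *
        (\<Sum>(p, q) \<in> {(p, q). p \<in> carrier G \<and> q \<in> carrier G \<and>
                          \<lbrakk>\<lbrakk>k, q \<triangleright> h\<rbrakk>, p \<triangleright> g\<rbrakk> = \<one> \<and> \<lbrakk>\<lbrakk>inv (q \<triangleright> h), p \<triangleright> g\<rbrakk>, k\<rbrakk> = \<one>}.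
           Omega G \<omega> (p \<triangleright> g) (q \<triangleright> h) k *
           transport_char G \<omega> g \<chi>1 p \<lbrakk>q \<triangleright> h, k\<rbrakk> *
           transport_char G \<omega> h \<chi>2 q \<lbrakk>inv k, p \<triangleright> inv g\<rbrakk> *
           \<chi>3 \<lbrakk>inv (q \<triangleright> h), p \<triangleright> g\<rbrakk>))"
proof -
  interpret group G by fact
  interpret cocycle_group G \<omega> by unfold_locales fact+
  note U = \<open>corresponds G \<omega> U g \<chi>1\<close> and V = \<open>corresponds G \<omega> V h \<chi>2\<close> and W = \<open>corresponds G \<omega> W k \<chi>3\<close>
  note gc [simp] = correspondsD(2)[OF U] correspondsD(2)[OF V] correspondsD(2)[OF W]
  note cl = conj_class_carrier[OF gc(1)] conj_class_carrier[OF gc(2)] conj_class_carrier[OF gc(3)]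
  let ?R = "\<lambda>x y. \<lbrakk>\<lbrakk>k, y\<rbrakk>, x\<rbrakk> = \<one> \<and> \<lbrakk>\<lbrakk>inv y, x\<rbrakk>, k\<rbrakk> = \<one>"
  let ?s = "\<lambda>x y. summand U V W x y k"
  let ?B = "borromean_tensor G \<omega> U V W"
  have fcl: "finite (conj_class G a)" if "a \<in> carrier G" for a
    using finite_subset[OF conj_class_carrier[OF that] fin] .
  have triple: "Omega G \<omega> x y z * char_at G \<omega> g \<chi>1 x \<lbrakk>y, z\<rbrakk> * char_at G \<omega> h \<chi>2 y \<lbrakk>inv z, inv x\<rbrakk> *
      char_at G \<omega> k \<chi>3 z \<lbrakk>inv y, x\<rbrakk> = summand U V W x y z"
    if m: "x \<in> conj_class G g" "y \<in> conj_class G h" "z \<in> conj_class G k" and c: "borromean_cond G x y z"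
    for x y z
  proof -
    have [simp]: "x \<in> carrier G" "y \<in> carrier G" "z \<in> carrier G" using m cl by auto
    show ?thesis
      by (simp add: summand_def char_at_eq[OF U m(1)] char_at_eq[OF V m(2)] char_at_eq[OF W m(3)]
          borromean_condD[OF c])
  qed
  have pair: "Omega G \<omega> x y k * char_at G \<omega> g \<chi>1 x \<lbrakk>y, k\<rbrakk> * char_at G \<omega> h \<chi>2 y \<lbrakk>inv k, inv x\<rbrakk> *
      \<chi>3 \<lbrakk>inv y, x\<rbrakk> = ?s x y"
    if m: "x \<in> conj_class G g" "y \<in> conj_class G h" and r: "?R x y" for x y
  proof -
    have [simp]: "x \<in> carrier G" "y \<in> carrier G" using m cl by auto
    have c: "borromean_cond G x y k" using r by (simp add: borromean_cond_iff)
    show ?thesis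
      by (simp add: summand_def char_at_eq[OF U m(1)] char_at_eq[OF V m(2)] correspondsD(3)[OF W]
          borromean_condD[OF c])
  qed
  have conjugators: "Omega G \<omega> (p \<triangleright> g) (q \<triangleright> h) k * transport_char G \<omega> g \<chi>1 p \<lbrakk>q \<triangleright> h, k\<rbrakk> *
      transport_char G \<omega> h \<chi>2 q \<lbrakk>inv k, p \<triangleright> inv g\<rbrakk> * \<chi>3 \<lbrakk>inv (q \<triangleright> h), p \<triangleright> g\<rbrakk> =
      ?s (p \<triangleright> g) (q \<triangleright> h)"
    if [simp]: "p \<in> carrier G" "q \<in> carrier G" and r: "?R (p \<triangleright> g) (q \<triangleright> h)" for p q
  proof -
    have c: "borromean_cond G (p \<triangleright> g) (q \<triangleright> h) k" using r by (simp add: borromean_cond_iff)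
    show ?thesis
      by (simp add: summand_def transport_char_eq[OF U] transport_char_eq[OF V] correspondsD(3)[OF W]
          borromean_condD[OF c] conjugate_inv)
  qed
  have B: "?B = of_nat (card (conj_class G k)) *
      (\<Sum>(x, y)\<in>{(x, y). x \<in> conj_class G g \<and> y \<in> conj_class G h \<and> ?R x y}. ?s x y)"
    by (rule borromean_tensor_two_sums[OF U V W])
  have transversals: "?B = of_nat (card (conj_class G k)) *
      (\<Sum>(p, q)\<in>{(p, q). p \<in> P \<and> q \<in> Q \<and> ?R (p \<triangleright> g) (q \<triangleright> h)}. ?s (p \<triangleright> g) (q \<triangleright> h))"
    if P: "left_transversal G (centralizer G g) P" and Q: "left_transversal G (centralizer G h) Q" for P Q
  proof -
    have "bij_betw (map_prod (\<lambda>p. p \<triangleright> g) (\<lambda>q. q \<triangleright> h)) (P \<times> Q) (conj_class G g \<times> conj_class G h)"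
      by (intro bij_betw_map_prod transversal_bij gc P Q)
    then have "bij_betw (map_prod (\<lambda>p. p \<triangleright> g) (\<lambda>q. q \<triangleright> h))
        {r \<in> P \<times> Q. ?R (fst (map_prod (\<lambda>p. p \<triangleright> g) (\<lambda>q. q \<triangleright> h) r))
          (snd (map_prod (\<lambda>p. p \<triangleright> g) (\<lambda>q. q \<triangleright> h) r))}
        {r \<in> conj_class G g \<times> conj_class G h. ?R (fst r) (snd r)}"
      by (rule bij_betw_Collect_image)
    from sum.reindex_bij_betw[OF this, of "\<lambda>r. ?s (fst r) (snd r)"]
    have "(\<Sum>(p, q)\<in>{r \<in> P \<times> Q. ?R (fst r \<triangleright> g) (snd r \<triangleright> h)}. ?s (p \<triangleright> g) (q \<triangleright> h)) =
        (\<Sum>(x, y)\<in>{r \<in> conj_class G g \<times> conj_class G h. ?R (fst r) (snd r)}. ?s x y)"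
      by (simp only: case_prod_unfold fst_map_prod snd_map_prod)
    moreover have "{r \<in> P \<times> Q. ?R (fst r \<triangleright> g) (snd r \<triangleright> h)} =
        {(p, q). p \<in> P \<and> q \<in> Q \<and> ?R (p \<triangleright> g) (q \<triangleright> h)}"
      "{r \<in> conj_class G g \<times> conj_class G h. ?R (fst r) (snd r)} =
        {(x, y). x \<in> conj_class G g \<and> y \<in> conj_class G h \<and> ?R x y}"
      by auto
    ultimately show ?thesis unfolding B by (simp only:)
  qed
  have all: "?B = of_nat (card (conj_class G g)) * of_nat (card (conj_class G h)) *
      of_nat (card (conj_class G k)) / (of_nat (order G))\<^sup>2 *
      (\<Sum>(p, q)\<in>{(p, q). p \<in> carrier G \<and> q \<in> carrier G \<and> ?R (p \<triangleright> g) (q \<triangleright> h)}.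
        ?s (p \<triangleright> g) (q \<triangleright> h))" (is "_ = ?c * ?T")
  proof -
    let ?t = "\<lambda>x y. if ?R x y then ?s x y else 0"
    let ?g = "of_nat (card (conj_class G g)) :: complex" and ?h = "of_nat (card (conj_class G h)) :: complex"
      and ?n = "of_nat (order G) :: complex"
    have n: "?n \<noteq> 0" using order_gt_0_iff_finite fin by simp
    \<comment> \<open>Constrained sums become full sums of functions that vanish off the constraint, so that the
      conjugators can be summed one at a time.\<close>
    have restrict: "(\<Sum>(x, y)\<in>{(x, y). x \<in> A \<and> y \<in> C \<and> r x y}. e x y) =
        (\<Sum>x\<in>A. \<Sum>y\<in>C. if r x y then e x y else 0)"
      if "finite A" "finite C" for A C :: "'a set" and r and e :: "'a \<Rightarrow> 'a \<Rightarrow> complex"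
      unfolding sum.cartesian_product
      by (rule sum.mono_neutral_cong_left) (use that in \<open>auto split: if_splits\<close>)
    have "?T = (\<Sum>p\<in>carrier G. \<Sum>q\<in>carrier G. ?t (p \<triangleright> g) (q \<triangleright> h))"
      by (rule restrict) (rule fin)+
    then have "?g * ?h * ?T = ?g * (\<Sum>p\<in>carrier G. ?h * (\<Sum>q\<in>carrier G. ?t (p \<triangleright> g) (q \<triangleright> h)))"
      by (simp only: sum_distrib_left mult_ac)
    also have "\<dots> = ?g * (\<Sum>p\<in>carrier G. ?n * (\<Sum>y\<in>conj_class G h. ?t (p \<triangleright> g) y))"
      by (simp only: sum_over_conjugators[OF fin gc(2), of "?t _"])
    also have "\<dots> = ?n * (\<Sum>x\<in>conj_class G g. ?n * (\<Sum>y\<in>conj_class G h. ?t x y))"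
      by (rule sum_over_conjugators[OF fin gc(1), of "\<lambda>x. ?n * (\<Sum>y\<in>conj_class G h. ?t x y)"])
    also have "\<dots> = ?n\<^sup>2 * (\<Sum>x\<in>conj_class G g. \<Sum>y\<in>conj_class G h. ?t x y)"
      by (simp only: power2_eq_square mult.assoc flip: sum_distrib_left)
    also have "(\<Sum>x\<in>conj_class G g. \<Sum>y\<in>conj_class G h. ?t x y) =
        (\<Sum>(x, y)\<in>{(x, y). x \<in> conj_class G g \<and> y \<in> conj_class G h \<and> ?R x y}. ?s x y)" (is "_ = ?S")
      by (rule restrict[symmetric]) (simp_all add: fcl)
    finally have eq: "?g * ?h * ?T = ?n\<^sup>2 * ?S" .
    have "?c * ?T = of_nat (card (conj_class G k)) * (?g * ?h * ?T) / ?n\<^sup>2" by simp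
    also have "\<dots> = of_nat (card (conj_class G k)) * ?S"
      unfolding eq using n by simp
    finally show ?thesis unfolding B ..
  qed
  show ?thesis
  proof (intro conjI ballI allI impI)
    show "?B = (\<Sum>(x, y, z) \<in> {(x, y, z). x \<in> conj_class G g \<and> y \<in> conj_class G h \<and>
        z \<in> conj_class G k \<and> borromean_cond G x y z}.
        Omega G \<omega> x y z * char_at G \<omega> g \<chi>1 x \<lbrakk>y, z\<rbrakk> * char_at G \<omega> h \<chi>2 y \<lbrakk>inv z, inv x\<rbrakk> *
        char_at G \<omega> k \<chi>3 z \<lbrakk>inv y, x\<rbrakk>)"
      unfolding borromean_tensor_sum[OF U V W] by (rule sum.cong) (auto simp: triple)
    show "?B = of_nat (card (conj_class G k)) *
        (\<Sum>(x, y) \<in> {(x, y). x \<in> conj_class G g \<and> y \<in> conj_class G h \<and> ?R x y}.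
        Omega G \<omega> x y k * char_at G \<omega> g \<chi>1 x \<lbrakk>y, k\<rbrakk> * char_at G \<omega> h \<chi>2 y \<lbrakk>inv k, inv x\<rbrakk> *
        \<chi>3 \<lbrakk>inv y, x\<rbrakk>)"
      unfolding B by (rule arg_cong[where f = "(*) _"], rule sum.cong) (auto simp: pair)
    show "?B = of_nat (card (conj_class G k)) *
        (\<Sum>(p, q) \<in> {(p, q). p \<in> P \<and> q \<in> Q \<and> ?R (p \<triangleright> g) (q \<triangleright> h)}.
        Omega G \<omega> (p \<triangleright> g) (q \<triangleright> h) k * transport_char G \<omega> g \<chi>1 p \<lbrakk>q \<triangleright> h, k\<rbrakk> *
        transport_char G \<omega> h \<chi>2 q \<lbrakk>inv k, p \<triangleright> inv g\<rbrakk> * \<chi>3 \<lbrakk>inv (q \<triangleright> h), p \<triangleright> g\<rbrakk>)"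
      if P: "left_transversal G (centralizer G g) P" and Q: "left_transversal G (centralizer G h) Q" for P Q
      unfolding transversals[OF P Q] using P Q
      by (intro arg_cong[where f = "(*) _"] sum.cong)
        (auto simp: conjugators left_transversal_def subset_iff)
    show "?B = of_nat (card (conj_class G g)) * of_nat (card (conj_class G h)) *
        of_nat (card (conj_class G k)) / (of_nat (order G))\<^sup>2 *
        (\<Sum>(p, q) \<in> {(p, q). p \<in> carrier G \<and> q \<in> carrier G \<and> ?R (p \<triangleright> g) (q \<triangleright> h)}.
        Omega G \<omega> (p \<triangleright> g) (q \<triangleright> h) k * transport_char G \<omega> g \<chi>1 p \<lbrakk>q \<triangleright> h, k\<rbrakk> *
        transport_char G \<omega> h \<chi>2 q \<lbrakk>inv k, p \<triangleright> inv g\<rbrakk> * \<chi>3 \<lbrakk>inv (q \<triangleright> h), p \<triangleright> g\<rbrakk>)"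
      unfolding all by (intro arg_cong[where f = "(*) _"] sum.cong) (auto simp: conjugators)
  qed (simp_all add: psi_alternative Omega_alternative)
qed

end
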